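(* Let $G=(V,E)$ be a finite simple graph with an automorphism $\theta$, $\theta^2=\mathrm{id}$, and let $\tau$ send the generator of $\mathbb{Z}_2$ to $-I$ (inversion in the origin). Then $G$ is $C_i$-isostatic on $\mathcal{Y}$ (i.e. there exists a framework $(G,p)$ on $\mathcal{Y}$ with $p(\theta(v))=-p(v)$ for all $v$ which is isostatic) if and only if $G$ is $(2,2)$-tight and $\theta$ fixes no vertex and no edge.
   Context: $\mathcal{Y}=\{(x,y,z):x^2+y^2=1\}$. A framework on $\mathcal{Y}$ is $(G,p)$ with $p:V\to\mathcal{Y}$, $p(u)\ne p(v)$ for edges $uv$. Its rigidity matrix is the $(|E|+|V|)\times3|V|$ matrix with a row for each edge $v_iv_j$ having $p(v_i)-p(v_j)$ in the columns of $v_i$ and $p(v_j)-p(v_i)$ in those of $v_j$, and a row for each vertex $v_i$, $p(v_i)=(x_i,y_i,z_i)$, having $(x_i,y_i,0)$ in its columns (zeros elsewhere). Isostatic means the rows are linearly independent and every kernel vector has the form $u_i=(0,0,a)+b(-y_i,x_i,0)$. A vertex is fixed by $\theta$ if $\theta(v)=v$; an edge $uv$ is fixed if $\{\theta(u),\theta(v)\}=\{u,v\}$. $G$ is $(2,2)$-tight if $|E|=2|V|-2$ and every subgraph $(V',E')$ with $V'\neq\emptyset$ has $|E'|\le2|V'|-2$. *)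

theory Defs
  imports "HOL-Analysis.Analysis"
begin

definition simple_graph :: "'a set \<Rightarrow> 'a set set \<Rightarrow> bool" where
  "simple_graph V E \<longleftrightarrow> finite V \<and>
     (\<forall>e\<in>E. \<exists>u v. e = {u, v} \<and> u \<noteq> v \<and> u \<in> V \<and> v \<in> V)"

definition graph_automorphism :: "'a set \<Rightarrow> 'a set set \<Rightarrow> ('a \<Rightarrow> 'a) \<Rightarrow> bool" where
  "graph_automorphism V E \<theta> \<longleftrightarrow> bij_betw \<theta> V V \<and>
     (\<forall>u\<in>V. \<forall>v\<in>V. {u, v} \<in> E \<longleftrightarrow> {\<theta> u, \<theta> v} \<in> E)"

definition involution_on :: "'a set \<Rightarrow> ('a \<Rightarrow> 'a) \<Rightarrow> bool" where
  "involution_on V \<theta> \<longleftrightarrow> (\<forall>v\<in>V. \<theta> (\<theta> v) = v)"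

definition fixes_some_vertex :: "'a set \<Rightarrow> ('a \<Rightarrow> 'a) \<Rightarrow> bool" where
  "fixes_some_vertex V \<theta> \<longleftrightarrow> (\<exists>v\<in>V. \<theta> v = v)"

definition fixes_some_edge :: "'a set set \<Rightarrow> ('a \<Rightarrow> 'a) \<Rightarrow> bool" where
  "fixes_some_edge E \<theta> \<longleftrightarrow> (\<exists>u v. {u, v} \<in> E \<and> {\<theta> u, \<theta> v} = {u, v})"

definition tight22 :: "'a set \<Rightarrow> 'a set set \<Rightarrow> bool" where
  "tight22 V E \<longleftrightarrow> int (card E) = 2 * int (card V) - 2 \<and>
     (\<forall>V' E'. V' \<subseteq> V \<and> V' \<noteq> {} \<and> E' \<subseteq> E \<and> (\<forall>e\<in>E'. e \<subseteq> V') \<longrightarrow>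
        int (card E') \<le> 2 * int (card V') - 2)"

definition on_cylinder :: "real^3 \<Rightarrow> bool" where
  "on_cylinder x \<longleftrightarrow> (x$1)^2 + (x$2)^2 = 1"

definition framework_on_Y :: "'a set \<Rightarrow> 'a set set \<Rightarrow> ('a \<Rightarrow> real^3) \<Rightarrow> bool" where
  "framework_on_Y V E p \<longleftrightarrow> (\<forall>v\<in>V. on_cylinder (p v)) \<and>
     (\<forall>u v. {u, v} \<in> E \<longrightarrow> p u \<noteq> p v)"

text \<open>Rows of the rigidity matrix, as linear functionals on velocity assignments
  q : V -> R^3 (the row vector paired with q). The edge row for uv is
  (p u - p v).q u + (p v - p u).q v, symmetric in the orientation of the edge.\<close>
definition edge_row :: "('a \<Rightarrow> real^3) \<Rightarrow> 'a set \<Rightarrow> ('a \<Rightarrow> real^3) \<Rightarrow> real" where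
  "edge_row p e q = (let (u, v) = (SOME (u, v). e = {u, v} \<and> u \<noteq> v) in
      inner (p u - p v) (q u) + inner (p v - p u) (q v))"

definition vertex_row :: "('a \<Rightarrow> real^3) \<Rightarrow> 'a \<Rightarrow> ('a \<Rightarrow> real^3) \<Rightarrow> real" where
  "vertex_row p v q = inner (vector [p v $ 1, p v $ 2, 0] :: real^3) (q v)"

definition rows_independent :: "'a set \<Rightarrow> 'a set set \<Rightarrow> ('a \<Rightarrow> real^3) \<Rightarrow> bool" where
  "rows_independent V E p \<longleftrightarrow>
     (\<forall>\<omega> c. (\<forall>q. (\<Sum>e\<in>E. \<omega> e * edge_row p e q) + (\<Sum>v\<in>V. c v * vertex_row p v q) = 0)
        \<longrightarrow> (\<forall>e\<in>E. \<omega> e = 0) \<and> (\<forall>v\<in>V. c v = 0))"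

definition in_kernel :: "'a set \<Rightarrow> 'a set set \<Rightarrow> ('a \<Rightarrow> real^3) \<Rightarrow> ('a \<Rightarrow> real^3) \<Rightarrow> bool" where
  "in_kernel V E p q \<longleftrightarrow> (\<forall>e\<in>E. edge_row p e q = 0) \<and> (\<forall>v\<in>V. vertex_row p v q = 0)"

definition isostatic :: "'a set \<Rightarrow> 'a set set \<Rightarrow> ('a \<Rightarrow> real^3) \<Rightarrow> bool" where
  "isostatic V E p \<longleftrightarrow> rows_independent V E p \<and>
     (\<forall>q. in_kernel V E p q \<longrightarrow>
        (\<exists>a b. \<forall>v\<in>V. q v = (vector [0, 0, a] :: real^3) + b *\<^sub>R (vector [- (p v $ 2), p v $ 1, 0] :: real^3)))"

definition Ci_isostatic :: "'a set \<Rightarrow> 'a set set \<Rightarrow> ('a \<Rightarrow> 'a) \<Rightarrow> bool" where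
  "Ci_isostatic V E \<theta> \<longleftrightarrow>
     (\<exists>p. framework_on_Y V E p \<and> (\<forall>v\<in>V. p (\<theta> v) = - p v) \<and> isostatic V E p)"

end

theory Submission
  imports Defs
begin

text \<open>
  A velocity field tangent to the cylinder consists of an angular part \<open>\<alpha>\<close> and a vertical part \<open>\<zeta>\<close>.
  In terms of these, the row of an edge \<open>uw\<close> is
  \<open>sin (t\<^sub>u - t\<^sub>w) (\<alpha>\<^sub>u - \<alpha>\<^sub>w) + (z\<^sub>u - z\<^sub>w) (\<zeta>\<^sub>u - \<zeta>\<^sub>w)\<close>, where \<open>t\<close> is the angle, and the trivial
  motions are the constant pairs \<open>(\<alpha>, \<zeta>)\<close>. The motions split into two parities under \<open>\<theta>\<close>:
  \<open>\<alpha>\<close> is even and \<open>\<zeta>\<close> is odd, or vice versa.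

  For sufficiency the graph is generalised to a symmetric multigraph, in which a double edge is a
  rigid bond: both \<open>\<alpha>\<close> and \<open>\<zeta>\<close> agree at its ends. This disposes of the vertices of degree 3 whose
  neighbours are pairwise adjacent, which have no inverse 1-extension among simple graphs. By
  induction remove an orbit \<open>{v, \<theta> v}\<close> of degree at most 3. If \<open>v\<close> has three neighbours outside its
  orbit, two of them, \<open>a\<close> and \<open>b\<close>, lie in no common tight set, and adding the orbit of the pair \<open>ab\<close>
  to the rest gives a smaller tight symmetric multigraph. Hence, modulo constants, the rest has at
  most one motion of each parity, not constant on \<open>{a, b}\<close>, and for a generic position of \<open>v\<close> the
  equations at \<open>v\<close> do not admit it.

  Necessity is a count of equations and unknowns. If \<open>\<alpha>\<close> is odd and \<open>\<zeta>\<close> is even, then the row of a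
  fixed edge vanishes, so that a fixed edge leaves too few equations for this parity.
\<close>

section \<open>Tight symmetric multigraphs\<close>

text \<open>Ordered pairs are summed, so that every edge counts twice and \<open>(2,2)\<close>-sparsity becomes
  \<open>degree_sum \<mu> X + 4 \<le> 4 * card X\<close>.\<close>

definition degree_sum :: "('a \<Rightarrow> 'a \<Rightarrow> nat) \<Rightarrow> 'a set \<Rightarrow> nat" where
  "degree_sum \<mu> X = (\<Sum>(u, w)\<in>X \<times> X. \<mu> u w)"

text \<open>An edge between \<open>v\<close> and \<open>\<theta> v\<close> must be a bond, hence the evenness condition: a single edge there
  would give a zero row for one of the two parities.\<close>

definition sym_multigraph :: "'a set \<Rightarrow> ('a \<Rightarrow> 'a) \<Rightarrow> ('a \<Rightarrow> 'a \<Rightarrow> nat) \<Rightarrow> bool" where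
  "sym_multigraph V \<theta> \<mu> \<longleftrightarrow> finite V \<and>
     (\<forall>v\<in>V. \<theta> v \<in> V \<and> \<theta> (\<theta> v) = v \<and> \<theta> v \<noteq> v) \<and>
     (\<forall>u\<in>V. \<forall>w\<in>V. \<mu> u w = \<mu> w u \<and> \<mu> (\<theta> u) (\<theta> w) = \<mu> u w) \<and>
     (\<forall>u\<in>V. \<mu> u u = 0 \<and> even (\<mu> u (\<theta> u)))"

definition sparse_multigraph :: "'a set \<Rightarrow> ('a \<Rightarrow> 'a \<Rightarrow> nat) \<Rightarrow> bool" where
  "sparse_multigraph V \<mu> \<longleftrightarrow> (\<forall>X\<subseteq>V. X \<noteq> {} \<longrightarrow> degree_sum \<mu> X + 4 \<le> 4 * card X)"

definition tight_multigraph :: "'a set \<Rightarrow> ('a \<Rightarrow> 'a \<Rightarrow> nat) \<Rightarrow> bool" where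
  "tight_multigraph V \<mu> \<longleftrightarrow> sparse_multigraph V \<mu> \<and> degree_sum \<mu> V + 4 = 4 * card V"

lemma sym_multigraphD:
  assumes "sym_multigraph V \<theta> \<mu>"
  shows "finite V"
    and "v \<in> V \<Longrightarrow> \<theta> v \<in> V" and "v \<in> V \<Longrightarrow> \<theta> (\<theta> v) = v" and "v \<in> V \<Longrightarrow> \<theta> v \<noteq> v"
    and "v \<in> V \<Longrightarrow> \<mu> v v = 0" and "v \<in> V \<Longrightarrow> even (\<mu> v (\<theta> v))"
    and "u \<in> V \<Longrightarrow> w \<in> V \<Longrightarrow> \<mu> (\<theta> u) (\<theta> w) = \<mu> u w"
    and "u \<in> V \<Longrightarrow> w \<in> V \<Longrightarrow> \<mu> u w = \<mu> w u"
  using assms unfolding sym_multigraph_def by blast+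

text \<open>The squares of \<open>X\<close> and \<open>Y\<close> intersect in the square of
  \<open>X \<inter> Y\<close>, while their union lies in the square of \<open>X \<union> Y\<close>.
  What may be lost are the edges between \<open>X - Y\<close> and \<open>Y - X\<close>.\<close>

lemma degree_sum_supermodular:
  assumes "finite X" "finite Y"
  shows "degree_sum \<mu> X + degree_sum \<mu> Y \<le> degree_sum \<mu> (X \<union> Y) + degree_sum \<mu> (X \<inter> Y)"
proof -
  have "degree_sum \<mu> X + degree_sum \<mu> Y =
      (\<Sum>(u, w)\<in>X \<times> X \<union> Y \<times> Y. \<mu> u w) + (\<Sum>(u, w)\<in>(X \<times> X) \<inter> (Y \<times> Y). \<mu> u w)"
    unfolding degree_sum_def by (rule sum.union_inter[symmetric]) (use assms in auto)
  also have "(X \<times> X) \<inter> (Y \<times> Y) = (X \<inter> Y) \<times> (X \<inter> Y)" by auto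
  also have "(\<Sum>(u, w)\<in>X \<times> X \<union> Y \<times> Y. \<mu> u w) \<le> degree_sum \<mu> (X \<union> Y)"
    unfolding degree_sum_def by (rule sum_mono2) (use assms in auto)
  finally show ?thesis by (simp add: degree_sum_def)
qed

lemma degree_sum_insert:
  assumes "finite X" "v \<notin> X" "\<And>w. w \<in> X \<Longrightarrow> \<mu> w v = \<mu> v w" "\<mu> v v = 0"
  shows "degree_sum \<mu> (insert v X) = degree_sum \<mu> X + 2 * (\<Sum>w\<in>X. \<mu> v w)"
proof -
  have "degree_sum \<mu> (insert v X) = (\<Sum>u\<in>insert v X. \<Sum>w\<in>insert v X. \<mu> u w)"
    by (simp add: degree_sum_def sum.cartesian_product)
  also have "\<dots> = (\<Sum>w\<in>X. \<mu> v w) + (\<Sum>u\<in>X. \<mu> u v + (\<Sum>w\<in>X. \<mu> u w))"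
    using assms by simp
  also have "\<dots> = (\<Sum>w\<in>X. \<mu> v w) + ((\<Sum>u\<in>X. \<mu> v u) + degree_sum \<mu> X)"
    using assms by (simp add: sum.distrib degree_sum_def sum.cartesian_product)
  finally show ?thesis by simp
qed

lemma degree_sum_pair:
  assumes "u \<noteq> w" "\<mu> u w = \<mu> w u" "\<mu> u u = 0" "\<mu> w w = 0"
  shows "degree_sum \<mu> {u, w} = 2 * \<mu> u w"
  using degree_sum_insert[of "{w}" u \<mu>] assms by (simp add: degree_sum_def)

lemma even_degree_sum:
  assumes "finite X" "\<And>u w. u \<in> X \<Longrightarrow> w \<in> X \<Longrightarrow> \<mu> u w = \<mu> w u" "\<And>u. u \<in> X \<Longrightarrow> \<mu> u u = 0"
  shows "even (degree_sum \<mu> X)"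
  using assms
proof (induction X rule: finite_induct)
  case (insert v X)
  have "degree_sum \<mu> (insert v X) = degree_sum \<mu> X + 2 * (\<Sum>w\<in>X. \<mu> v w)"
    using insert by (intro degree_sum_insert) auto
  then show ?case using insert by simp
qed (simp add: degree_sum_def)

lemma sym_multigraph_subset:
  assumes "sym_multigraph V \<theta> \<mu>" "X \<subseteq> V" "\<theta> ` X \<subseteq> X"
  shows "sym_multigraph X \<theta> \<mu>"
proof -
  note D = sym_multigraphD[OF assms(1)]
  have X: "v \<in> V" "\<theta> v \<in> X" if "v \<in> X" for v using assms(2,3) that by auto
  show ?thesis
    unfolding sym_multigraph_def
  proof (intro conjI ballI)
    show "finite X" using D(1) assms(2) finite_subset by auto
    fix u assume u: "u \<in> X"
    show "\<theta> u \<in> X" "\<theta> (\<theta> u) = u" "\<theta> u \<noteq> u" "\<mu> u u = 0" "even (\<mu> u (\<theta> u))"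
      using X[OF u] D(3-6) by auto
    fix w assume w: "w \<in> X"
    show "\<mu> u w = \<mu> w u" by (rule D(8)[OF X(1)[OF u] X(1)[OF w]])
    show "\<mu> (\<theta> u) (\<theta> w) = \<mu> u w" by (rule D(7)[OF X(1)[OF u] X(1)[OF w]])
  qed
qed

lemma degree_sum_image:
  assumes "sym_multigraph V \<theta> \<mu>" "X \<subseteq> V"
  shows "degree_sum \<mu> (\<theta> ` X) = degree_sum \<mu> X" and "card (\<theta> ` X) = card X"
proof -
  have inj: "inj_on \<theta> X"
    by (rule inj_on_inverseI[where g = \<theta>]) (use assms(2) sym_multigraphD(3,7)[OF assms(1)] in auto)
  then show "card (\<theta> ` X) = card X" by (rule card_image)
  have "degree_sum \<mu> (\<theta> ` X) = (\<Sum>u\<in>\<theta> ` X. \<Sum>w\<in>\<theta> ` X. \<mu> u w)"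
    by (simp add: degree_sum_def sum.cartesian_product)
  also have "\<dots> = (\<Sum>u\<in>X. \<Sum>w\<in>X. \<mu> (\<theta> u) (\<theta> w))"
    using inj by (simp add: sum.reindex)
  also have "\<dots> = (\<Sum>u\<in>X. \<Sum>w\<in>X. \<mu> u w)"
    by (intro sum.cong refl sym_multigraphD(7)[OF assms(1)]) (use assms(2) in auto)
  finally show "degree_sum \<mu> (\<theta> ` X) = degree_sum \<mu> X"
    by (simp add: degree_sum_def sum.cartesian_product)
qed

text \<open>By symmetry \<open>v\<close> and \<open>\<theta> v\<close> have the same total
  multiplicity into \<open>W\<close>, and every edge counts twice, hence the factor 4. The edge
  inside the orbit only contributes its own two ordered pairs.\<close>

lemma degree_sum_remove_orbit:
  assumes G: "sym_multigraph V \<theta> \<mu>" and v: "v \<in> V" and W: "W = V - {v, \<theta> v}"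
  shows "degree_sum \<mu> V = degree_sum \<mu> W + 4 * (\<Sum>w\<in>W. \<mu> v w) + 2 * \<mu> v (\<theta> v)"
    and "card V = card W + 2" and "\<theta> ` W = W"
proof -
  have fin: "finite W" and tv: "\<theta> v \<in> V" "\<theta> v \<noteq> v" "\<theta> (\<theta> v) = v"
    and V: "V = insert v (insert (\<theta> v) W)"
    using sym_multigraphD[OF G] v unfolding W by auto
  have sub: "\<theta> ` W \<subseteq> W"
  proof
    fix w assume "w \<in> \<theta> ` W"
    then obtain w' where w': "w' \<in> V" "w' \<noteq> v" "w' \<noteq> \<theta> v" "w = \<theta> w'" unfolding W by auto
    then have "\<theta> w = w'" "w \<in> V" using sym_multigraphD(2,3)[OF G] by auto
    then show "w \<in> W" using w' tv unfolding W by auto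
  qed
  have inj: "inj_on \<theta> W"
    by (rule inj_on_inverseI[where g = \<theta>]) (use sym_multigraphD(3)[OF G] W in auto)
  show im: "\<theta> ` W = W"
    using fin sub inj by (simp add: endo_inj_surj)
  have "v \<notin> W" "\<theta> v \<notin> W" unfolding W by auto
  then show "card V = card W + 2"
    using fin tv V by simp
  have "(\<Sum>w\<in>W. \<mu> (\<theta> v) w) = (\<Sum>w\<in>\<theta> ` W. \<mu> (\<theta> v) w)" by (simp add: im)
  also have "\<dots> = (\<Sum>w\<in>W. \<mu> (\<theta> v) (\<theta> w))" using inj by (simp add: sum.reindex)
  also have "\<dots> = (\<Sum>w\<in>W. \<mu> v w)"
    by (intro sum.cong refl) (use sym_multigraphD(7)[OF G] v W in auto)
  finally have S: "(\<Sum>w\<in>W. \<mu> (\<theta> v) w) = (\<Sum>w\<in>W. \<mu> v w)" .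
  have "degree_sum \<mu> V = degree_sum \<mu> (insert (\<theta> v) W) + 2 * (\<Sum>w\<in>insert (\<theta> v) W. \<mu> v w)"
    unfolding V by (rule degree_sum_insert) (use sym_multigraphD(5,8)[OF G] v tv fin W in \<open>auto\<close>)
  also have "degree_sum \<mu> (insert (\<theta> v) W) = degree_sum \<mu> W + 2 * (\<Sum>w\<in>W. \<mu> (\<theta> v) w)"
    by (rule degree_sum_insert) (use sym_multigraphD(5,8)[OF G] v tv fin W in \<open>auto\<close>)
  finally show "degree_sum \<mu> V = degree_sum \<mu> W + 4 * (\<Sum>w\<in>W. \<mu> v w) + 2 * \<mu> v (\<theta> v)"
    using fin \<open>\<theta> v \<notin> W\<close> S by simp
qed

text \<open>Orbits are stripped one at a time. Each changes the degree sum by a multiple of 4,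
  because the multiplicity inside an orbit is even.\<close>

lemma sym_degree_sum_parity:
  assumes "sym_multigraph V \<theta> \<mu>"
  shows "4 dvd degree_sum \<mu> V \<and> even (card V)"
  using assms
proof (induction "card V" arbitrary: V rule: less_induct)
  case less
  show ?case
  proof (cases "V = {}")
    case True
    then show ?thesis by (simp add: degree_sum_def)
  next
    case False
    then obtain v where v: "v \<in> V" by auto
    define W where "W = V - {v, \<theta> v}"
    note R = degree_sum_remove_orbit[OF less.prems v W_def]
    have "sym_multigraph W \<theta> \<mu>"
      using less.prems by (rule sym_multigraph_subset) (use R(3) W_def in auto)
    then have IH: "4 dvd degree_sum \<mu> W \<and> even (card W)" using less.hyps R(2) by simp
    have "even (\<mu> v (\<theta> v))" using sym_multigraphD(6)[OF less.prems v] .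
    then have "4 dvd 2 * \<mu> v (\<theta> v)" by presburger
    then show ?thesis using IH R by simp
  qed
qed

text \<open>The deficiency \<open>4 * card X - 4 - degree_sum \<mu> X\<close> is nonnegative on
  nonempty subsets of \<open>V\<close> and submodular. If it vanishes at two intersecting sets, it
  vanishes at their union.\<close>

lemma tight_union:
  assumes "sparse_multigraph V \<mu>" "finite V" "X \<subseteq> V" "Y \<subseteq> V" "X \<inter> Y \<noteq> {}"
    and X: "degree_sum \<mu> X + 4 = 4 * card X" and Y: "degree_sum \<mu> Y + 4 = 4 * card Y"
  shows "degree_sum \<mu> (X \<union> Y) + 4 = 4 * card (X \<union> Y)"
proof -
  have fin: "finite X" "finite Y" using assms finite_subset by auto
  have "X \<union> Y \<subseteq> V" "X \<union> Y \<noteq> {}" "X \<inter> Y \<subseteq> V" using assms(3-5) by auto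
  then have "degree_sum \<mu> (X \<union> Y) + 4 \<le> 4 * card (X \<union> Y)"
    "degree_sum \<mu> (X \<inter> Y) + 4 \<le> 4 * card (X \<inter> Y)"
    using assms(1,5) unfolding sparse_multigraph_def by blast+
  moreover note degree_sum_supermodular[OF fin, of \<mu>] card_Un_Int[OF fin]
  ultimately show ?thesis using X Y by linarith
qed

section \<open>Adding the orbit of an edge\<close>

definition add_orbit :: "('a \<Rightarrow> 'a) \<Rightarrow> 'a \<Rightarrow> 'a \<Rightarrow> ('a \<Rightarrow> 'a \<Rightarrow> nat) \<Rightarrow> 'a \<Rightarrow> 'a \<Rightarrow> nat" where
  "add_orbit \<theta> a b \<mu> u w = \<mu> u w + of_bool ({u, w} = {a, b}) + of_bool ({u, w} = {\<theta> a, \<theta> b})"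

lemma sum_of_bool_pair:
  assumes "finite X" "a \<noteq> b"
  shows "(\<Sum>(u, w)\<in>X \<times> X. of_bool ({u, w} = {a, b}) :: nat) = (if a \<in> X \<and> b \<in> X then 2 else 0)"
proof -
  have "(\<Sum>(u, w)\<in>X \<times> X. of_bool ({u, w} = {a, b}) :: nat) =
      card ((X \<times> X) \<inter> {(u, w). {u, w} = {a, b}})"
    using assms by (simp add: case_prod_unfold sum_of_bool_eq Int_def)
  also have "(X \<times> X) \<inter> {(u, w). {u, w} = {a, b}} = (if a \<in> X \<and> b \<in> X then {(a, b), (b, a)} else {})"
    by (auto simp: doubleton_eq_iff)
  finally show ?thesis using assms by auto
qed

lemma degree_sum_add_orbit:
  assumes "finite X" "a \<noteq> b" "\<theta> a \<noteq> \<theta> b"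
  shows "degree_sum (add_orbit \<theta> a b \<mu>) X = degree_sum \<mu> X
    + (if a \<in> X \<and> b \<in> X then 2 else 0) + (if \<theta> a \<in> X \<and> \<theta> b \<in> X then 2 else 0)"
proof -
  have "degree_sum (add_orbit \<theta> a b \<mu>) X = degree_sum \<mu> X
      + (\<Sum>(u, w)\<in>X \<times> X. of_bool ({u, w} = {a, b})) + (\<Sum>(u, w)\<in>X \<times> X. of_bool ({u, w} = {\<theta> a, \<theta> b}))"
    by (simp add: degree_sum_def add_orbit_def case_prod_unfold sum.distrib)
  then show ?thesis
    using sum_of_bool_pair[OF assms(1,2)] sum_of_bool_pair[OF assms(1,3)] by simp
qed

text \<open>If \<open>b = \<theta> a\<close>, the two summands of \<open>add_orbit\<close> hit the
  same pair, so that a whole bond is added. This keeps the multiplicity inside an orbit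
  even.\<close>

lemma sym_multigraph_add_orbit:
  assumes G: "sym_multigraph V \<theta> \<mu>" and ab: "a \<in> V" "b \<in> V" "a \<noteq> b"
  shows "sym_multigraph V \<theta> (add_orbit \<theta> a b \<mu>)"
proof -
  have T: "\<theta> v \<in> V" "\<theta> (\<theta> v) = v" "\<theta> v \<noteq> v" if "v \<in> V" for v
    using sym_multigraphD(2-4)[OF G that] by auto
  have inj: "\<theta> u = \<theta> w \<longleftrightarrow> u = w" if "u \<in> V" "w \<in> V" for u w
    using T that by metis
  have sw: "\<theta> u = w \<longleftrightarrow> u = \<theta> w" if "u \<in> V" "w \<in> V" for u w
    using T that by metis
  have 1: "{\<theta> u, \<theta> w} = {\<theta> a, \<theta> b} \<longleftrightarrow> {u, w} = {a, b}" if "u \<in> V" "w \<in> V" for u w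
    using inj that ab by (simp add: doubleton_eq_iff)
  have 2: "{\<theta> u, \<theta> w} = {a, b} \<longleftrightarrow> {u, w} = {\<theta> a, \<theta> b}" if "u \<in> V" "w \<in> V" for u w
    using sw that ab by (simp add: doubleton_eq_iff)
  have 3: "{u, \<theta> u} = {a, b} \<longleftrightarrow> {u, \<theta> u} = {\<theta> a, \<theta> b}" if "u \<in> V" for u
    using 2[of u "\<theta> u"] T[OF that] that by (simp add: insert_commute)
  have 4: "\<theta> a \<noteq> \<theta> b" using inj ab by simp
  show ?thesis
    unfolding sym_multigraph_def
  proof (intro conjI ballI)
    fix u assume u: "u \<in> V"
    show "add_orbit \<theta> a b \<mu> u u = 0"
      using sym_multigraphD(5)[OF G u] ab 4 by (auto simp: add_orbit_def doubleton_eq_iff)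
    show "even (add_orbit \<theta> a b \<mu> u (\<theta> u))"
      using sym_multigraphD(6)[OF G u] 3[OF u] by (auto simp: add_orbit_def)
    fix w assume w: "w \<in> V"
    show "add_orbit \<theta> a b \<mu> u w = add_orbit \<theta> a b \<mu> w u"
      using sym_multigraphD(8)[OF G u w] by (simp add: add_orbit_def insert_commute)
    show "add_orbit \<theta> a b \<mu> (\<theta> u) (\<theta> w) = add_orbit \<theta> a b \<mu> u w"
      using sym_multigraphD(7)[OF G u w] u w by (simp add: add_orbit_def 1 2)
  qed (use sym_multigraphD(1)[OF G] T in auto)
qed

lemma nat_parity_gap:
  fixes n c :: nat
  shows "even n \<Longrightarrow> n + 4 \<le> 4 * c \<Longrightarrow> n + 4 \<noteq> 4 * c \<Longrightarrow> n + 6 \<le> 4 * c"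
    and "even n \<Longrightarrow> \<not> n + 8 \<le> 4 * c \<Longrightarrow> 4 * c \<le> n + 6"
    and "4 dvd n \<Longrightarrow> n + 4 \<le> 4 * c \<Longrightarrow> n + 4 \<noteq> 4 * c \<Longrightarrow> n + 8 \<le> 4 * c"
  by presburger+

text \<open>A \<open>\<theta>\<close>-invariant set misses tightness by a multiple of 4. Hence if a set \<open>X\<close> contains both pairs
  of the orbit and misses tightness by at most 2, supermodularity makes \<open>X \<union> \<theta> X\<close> or \<open>X \<inter> \<theta> X\<close> tight.\<close>

lemma sparse_add_orbit:
  assumes G: "sym_multigraph V \<theta> \<mu>" and sp: "sparse_multigraph V \<mu>"
    and ab: "a \<in> V" "b \<in> V" "a \<noteq> b"
    and nt: "\<And>X. X \<subseteq> V \<Longrightarrow> a \<in> X \<Longrightarrow> b \<in> X \<Longrightarrow> degree_sum \<mu> X + 4 \<noteq> 4 * card X"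
  shows "sparse_multigraph V (add_orbit \<theta> a b \<mu>)"
  unfolding sparse_multigraph_def
proof (intro allI impI)
  fix X assume X: "X \<subseteq> V" "X \<noteq> {}"
  have T: "\<theta> v \<in> V" "\<theta> (\<theta> v) = v" if "v \<in> V" for v
    using sym_multigraphD(2-4)[OF G that] by auto
  have fin: "finite X" using sym_multigraphD(1)[OF G] X finite_subset by auto
  have ne: "\<theta> a \<noteq> \<theta> b" using T ab by metis
  have spX: "degree_sum \<mu> X + 4 \<le> 4 * card X" using sp X by (auto simp: sparse_multigraph_def)
  have evX: "even (degree_sum \<mu> X)"
    using fin by (rule even_degree_sum) (use sym_multigraphD(5,8)[OF G] X in auto)
  let ?Y = "\<theta> ` X"
  have Y: "?Y \<subseteq> V" "finite ?Y" using T X fin by auto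
  note YX = degree_sum_image[OF G X(1)]
  have inY: "w \<in> ?Y" if "\<theta> w \<in> X" "w \<in> V" for w
    using that T by (metis imageI)
  \<comment> \<open>A tight set containing \<open>\<theta> a\<close> and \<open>\<theta> b\<close>
    would have a tight image under \<theta> that contains \<open>a\<close> and
    \<open>b\<close>.\<close>
  have nX: "\<not> (degree_sum \<mu> X + 4 = 4 * card X)" if "a \<in> X \<and> b \<in> X \<or> \<theta> a \<in> X \<and> \<theta> b \<in> X"
    using that
  proof
    assume "a \<in> X \<and> b \<in> X" then show ?thesis using nt X by blast
  next
    assume "\<theta> a \<in> X \<and> \<theta> b \<in> X"
    then have "a \<in> ?Y" "b \<in> ?Y" using inY ab by auto
    then show ?thesis using nt[OF Y(1)] YX by simp
  qed
  show "degree_sum (add_orbit \<theta> a b \<mu>) X + 4 \<le> 4 * card X"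
  proof (cases "a \<in> X \<and> b \<in> X \<and> \<theta> a \<in> X \<and> \<theta> b \<in> X")
    \<comment> \<open>At most one of the two pairs lies in \<open>X\<close>, so the sum grows by at
      most 2, and evenness gives a set that is not tight a slack of at least 2.\<close>
    case False
    then have "degree_sum (add_orbit \<theta> a b \<mu>) X \<le> degree_sum \<mu> X
      + (if a \<in> X \<and> b \<in> X \<or> \<theta> a \<in> X \<and> \<theta> b \<in> X then 2 else 0)"
      using degree_sum_add_orbit[OF fin ab(3) ne, of \<mu>] by auto
    moreover have "degree_sum \<mu> X + 6 \<le> 4 * card X"
      if "a \<in> X \<and> b \<in> X \<or> \<theta> a \<in> X \<and> \<theta> b \<in> X"
      using nat_parity_gap(1)[OF evX spX nX[OF that]] .
    ultimately show ?thesis using spX by (auto split: if_splits)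
  next
    case True
    then have in_Y: "a \<in> ?Y" "b \<in> ?Y" using inY ab by auto
    have "degree_sum \<mu> X + 8 \<le> 4 * card X"
    proof (rule ccontr)
      assume "\<not> ?thesis"
      then have near: "4 * card X \<le> degree_sum \<mu> X + 6" using nat_parity_gap(2)[OF evX] by blast
      have "\<theta> ` ?Y = (\<lambda>v. v) ` X"
        unfolding image_image by (rule image_cong) (use T X(1) in auto)
      then have "\<theta> ` ?Y = X" by simp
      then have "\<theta> ` (X \<union> ?Y) \<subseteq> X \<union> ?Y" "\<theta> ` (X \<inter> ?Y) \<subseteq> X \<inter> ?Y"
        by blast+
      then have "sym_multigraph (X \<union> ?Y) \<theta> \<mu>" "sym_multigraph (X \<inter> ?Y) \<theta> \<mu>"
        using sym_multigraph_subset[OF G, of "X \<union> ?Y"] sym_multigraph_subset[OF G, of "X \<inter> ?Y"] X Y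
        by auto
      then have d: "4 dvd degree_sum \<mu> (X \<union> ?Y)" "4 dvd degree_sum \<mu> (X \<inter> ?Y)"
        using sym_degree_sum_parity by auto
      have U: "X \<union> ?Y \<subseteq> V" "X \<inter> ?Y \<subseteq> V" "X \<union> ?Y \<noteq> {}" "X \<inter> ?Y \<noteq> {}"
        using X Y True in_Y by auto
      have le: "degree_sum \<mu> (X \<union> ?Y) + 4 \<le> 4 * card (X \<union> ?Y)"
        "degree_sum \<mu> (X \<inter> ?Y) + 4 \<le> 4 * card (X \<inter> ?Y)"
        using sp U unfolding sparse_multigraph_def by blast+
      have neq: "degree_sum \<mu> (X \<union> ?Y) + 4 \<noteq> 4 * card (X \<union> ?Y)"
        "degree_sum \<mu> (X \<inter> ?Y) + 4 \<noteq> 4 * card (X \<inter> ?Y)"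
        using nt[OF U(1)] nt[OF U(2)] True in_Y by auto
      have "degree_sum \<mu> (X \<union> ?Y) + 8 \<le> 4 * card (X \<union> ?Y)"
        using nat_parity_gap(3)[OF d(1) le(1) neq(1)] .
      moreover have "degree_sum \<mu> (X \<inter> ?Y) + 8 \<le> 4 * card (X \<inter> ?Y)"
        using nat_parity_gap(3)[OF d(2) le(2) neq(2)] .
      moreover note degree_sum_supermodular[OF fin Y(2), of \<mu>] card_Un_Int[OF fin Y(2)]
      ultimately show False using near YX by linarith
    qed
    then show ?thesis using degree_sum_add_orbit[OF fin ab(3) ne, of \<mu>] by auto
  qed
qed

section \<open>Distributions of two or three units of multiplicity\<close>

lemma sum_eq_SucE:
  fixes f :: "'a \<Rightarrow> nat"
  assumes "finite W" "sum f W = Suc n"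
  obtains a where "a \<in> W" "f a \<noteq> 0" "sum (f(a := f a - 1)) W = n"
proof -
  obtain a where a: "a \<in> W" "f a \<noteq> 0" using assms by (metis Zero_not_Suc sum.neutral)
  have "sum (f(a := f a - 1)) W = (f a - 1) + sum f (W - {a})"
    using assms(1) a by (simp add: sum.remove)
  moreover have "sum f W = f a + sum f (W - {a})" using assms(1) a by (simp add: sum.remove)
  ultimately show thesis using a assms(2) that by simp
qed

lemma sum_eq_2_cases:
  fixes f :: "'a \<Rightarrow> nat"
  assumes "finite W" "sum f W = 2"
  obtains (double) a where "a \<in> W" "f a = 2"
    | (distinct) a b where "a \<in> W" "b \<in> W" "a \<noteq> b" "f a = 1" "f b = 1"
proof -
  obtain a where a: "a \<in> W" "f a \<noteq> 0" "sum (f(a := f a - 1)) W = 1"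
    by (rule sum_eq_SucE[of W f 1]) (use assms in auto)
  obtain b where b: "b \<in> W" "(f(a := f a - 1)) b \<noteq> 0"
      "sum ((f(a := f a - 1))(b := (f(a := f a - 1)) b - 1)) W = 0"
    by (rule sum_eq_SucE[of W "f(a := f a - 1)" 0]) (use assms a in auto)
  then have "\<forall>w\<in>W. ((f(a := f a - 1))(b := (f(a := f a - 1)) b - 1)) w = 0"
    using assms(1) by (simp only: sum_eq_0_iff)
  then have z: "((f(a := f a - 1))(b := (f(a := f a - 1)) b - 1)) w = 0" if "w \<in> W" for w
    using that by blast
  show thesis
  proof (cases "a = b")
    case True
    then have "f a = 2" using b(2) z[OF a(1)] by simp
    then show thesis using a(1) that(1) by blast
  next
    case False
    then have "f a = 1" "f b = 1" using a(2) b(2) z[OF a(1)] z[OF b(1)] by auto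
    then show thesis using a(1) b(1) False that(2) by blast
  qed
qed

text \<open>Peeling off one unit leaves a total of 2. The bound on the values excludes all three
  units in one place; for multiplicities it comes from sparsity of a two-element set.\<close>

lemma sum_eq_3_cases:
  fixes f :: "'a \<Rightarrow> nat"
  assumes "finite W" "sum f W = 3" "\<forall>w\<in>W. f w \<le> 2"
  obtains (double) a b where "a \<in> W" "b \<in> W" "a \<noteq> b" "f a = 2" "f b = 1"
    | (distinct) a b c where "a \<in> W" "b \<in> W" "c \<in> W" "a \<noteq> b" "a \<noteq> c" "b \<noteq> c"
        "f a = 1" "f b = 1" "f c = 1"
proof -
  obtain a where a: "a \<in> W" "f a \<noteq> 0" "sum (f(a := f a - 1)) W = 2"
    by (rule sum_eq_SucE[of W f 2]) (use assms(1,2) in auto)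
  from assms(1) a(3) show thesis
  proof (cases rule: sum_eq_2_cases)
    case (double b)
    then have ab: "a \<noteq> b" using a(1,2) assms(3) by fastforce
    have "sum (f(a := f a - 1)) {a, b} \<le> 2"
      unfolding a(3)[symmetric] by (rule sum_mono2) (use assms(1) a double in auto)
    then have "f a = 1" using double(2) ab a(2) by simp
    then show thesis using that(1)[of b a] double ab a(1) by auto
  next
    case (distinct b c)
    show thesis
    proof (cases "a = b \<or> a = c")
      case True
      then show thesis using distinct a(1,2) that(1)[of b c] that(1)[of c b] by auto
    next
      case False
      have "sum (f(a := f a - 1)) {a, b, c} \<le> 2"
        unfolding a(3)[symmetric] by (rule sum_mono2) (use assms(1) a distinct in auto)
      then have "f a = 1" using distinct(3-5) False a(2) by simp
      then show thesis using that(2)[of a b c] distinct False a by auto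
    qed
  qed
qed

section \<open>Motions of a multigraph on the cylinder\<close>

text \<open>For a vertex at \<open>(cos t, sin t, z)\<close> the coefficient of the angular
  difference is the sine of the difference of the two angles. Coordinates replace angles so that
  genericity becomes a statement about polynomials.\<close>

definition bond_motion ::
  "'a set \<Rightarrow> ('a \<Rightarrow> 'a \<Rightarrow> nat) \<Rightarrow> ('a \<Rightarrow> real) \<Rightarrow> ('a \<Rightarrow> real) \<Rightarrow> ('a \<Rightarrow> real) \<Rightarrow> ('a \<Rightarrow> real) \<Rightarrow> ('a \<Rightarrow> real) \<Rightarrow> bool"
  where "bond_motion V \<mu> x y z \<alpha> \<zeta> \<longleftrightarrow> (\<forall>u\<in>V. \<forall>w\<in>V.
     (\<mu> u w = 1 \<longrightarrow> (y u * x w - x u * y w) * (\<alpha> u - \<alpha> w) + (z u - z w) * (\<zeta> u - \<zeta> w) = 0) \<and>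
     (2 \<le> \<mu> u w \<longrightarrow> \<alpha> u = \<alpha> w \<and> \<zeta> u = \<zeta> w))"

text \<open>Under inversion the sine coefficient of an edge is unchanged and the height difference
  changes sign. With opposite signs for \<alpha> and \<zeta>, the row of the image edge is therefore
  \<sigma> times the row of the edge, and one equation per orbit suffices.\<close>

definition has_parity :: "'a set \<Rightarrow> ('a \<Rightarrow> 'a) \<Rightarrow> real \<Rightarrow> ('a \<Rightarrow> real) \<Rightarrow> ('a \<Rightarrow> real) \<Rightarrow> bool" where
  "has_parity V \<theta> \<sigma> \<alpha> \<zeta> \<longleftrightarrow> (\<forall>v\<in>V. \<alpha> (\<theta> v) = \<sigma> * \<alpha> v \<and> \<zeta> (\<theta> v) = - \<sigma> * \<zeta> v)"

text \<open>The last clause keeps the horizontal directions of different orbits from being parallel;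
  only vertices of one orbit have zero sine coefficient.\<close>

definition sym_placement ::
  "'a set \<Rightarrow> ('a \<Rightarrow> 'a) \<Rightarrow> ('a \<Rightarrow> real) \<Rightarrow> ('a \<Rightarrow> real) \<Rightarrow> ('a \<Rightarrow> real) \<Rightarrow> bool" where
  "sym_placement V \<theta> x y z \<longleftrightarrow>
     (\<forall>v\<in>V. (x v)\<^sup>2 + (y v)\<^sup>2 = 1 \<and> x (\<theta> v) = - x v \<and> y (\<theta> v) = - y v \<and> z (\<theta> v) = - z v) \<and>
     (\<forall>u\<in>V. \<forall>w\<in>V. w \<noteq> u \<and> w \<noteq> \<theta> u \<longrightarrow> y u * x w - x u * y w \<noteq> 0)"

definition parity_rigid ::
  "'a set \<Rightarrow> ('a \<Rightarrow> 'a) \<Rightarrow> ('a \<Rightarrow> 'a \<Rightarrow> nat) \<Rightarrow> ('a \<Rightarrow> real) \<Rightarrow> ('a \<Rightarrow> real) \<Rightarrow> ('a \<Rightarrow> real) \<Rightarrow> bool" where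
  "parity_rigid V \<theta> \<mu> x y z \<longleftrightarrow> (\<forall>\<sigma>\<in>{1, -1}. \<forall>\<alpha> \<zeta>.
     bond_motion V \<mu> x y z \<alpha> \<zeta> \<and> has_parity V \<theta> \<sigma> \<alpha> \<zeta> \<longrightarrow>
     (\<exists>A B. \<forall>v\<in>V. \<alpha> v = A \<and> \<zeta> v = B))"

section \<open>Generic position of a new vertex\<close>

text \<open>Generic means for all but finitely many parameters, expressed by the cofinite filter, so
  that finitely many generic conditions can be imposed together.\<close>

lemma eventually_quadratic_neq_0:
  fixes c\<^sub>0 c\<^sub>1 c\<^sub>2 :: real
  assumes "c\<^sub>0 \<noteq> 0 \<or> c\<^sub>1 \<noteq> 0 \<or> c\<^sub>2 \<noteq> 0"
  shows "\<forall>\<^sub>F k in cofinite. c\<^sub>0 + c\<^sub>1 * k + c\<^sub>2 * k\<^sup>2 \<noteq> 0"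
proof -
  have "finite {k. poly [:c\<^sub>0, c\<^sub>1, c\<^sub>2:] k = 0}"
    by (rule poly_roots_finite) (use assms in auto)
  then show ?thesis
    by (simp add: eventually_cofinite algebra_simps power2_eq_square)
qed

lemma eventually_linear_neq_0:
  fixes c\<^sub>0 c\<^sub>1 :: real
  assumes "c\<^sub>0 \<noteq> 0 \<or> c\<^sub>1 \<noteq> 0"
  shows "\<forall>\<^sub>F k in cofinite. c\<^sub>0 + c\<^sub>1 * k \<noteq> 0"
  using eventually_quadratic_neq_0[of c\<^sub>0 c\<^sub>1 0] assms by simp

text \<open>A line meets a circle at most twice: a point \<open>a + t (b - a)\<close> of the circle
  satisfies \<open>t (t - 1) = 0\<close>, so it is \<open>a\<close> or \<open>b\<close>.\<close>

lemma circle_not_collinear: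
  fixes xa ya xb yb xc yc :: real
  assumes "xa\<^sup>2 + ya\<^sup>2 = 1" "xb\<^sup>2 + yb\<^sup>2 = 1" "xc\<^sup>2 + yc\<^sup>2 = 1"
    and ab: "xa \<noteq> xb \<or> ya \<noteq> yb" and ac: "xa \<noteq> xc \<or> ya \<noteq> yc" and bc: "xb \<noteq> xc \<or> yb \<noteq> yc"
  shows "(xb - xa) * (yc - ya) - (xc - xa) * (yb - ya) \<noteq> 0"
proof
  assume col: "(xb - xa) * (yc - ya) - (xc - xa) * (yb - ya) = 0"
  define d e f g where "d = xb - xa" and "e = yb - ya" and "f = xc - xa" and "g = yc - ya"
  have 1: "d * g = f * e" using col unfolding d_def e_def f_def g_def by simp
  have d: "2 * (xa * d + ya * e) + (d\<^sup>2 + e\<^sup>2) = 0" "2 * (xa * f + ya * g) + (f\<^sup>2 + g\<^sup>2) = 0"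
    using assms(1-3) unfolding d_def e_def f_def g_def by (simp_all add: power2_eq_square algebra_simps)
  have nz: "d\<^sup>2 + e\<^sup>2 \<noteq> 0" "f\<^sup>2 + g\<^sup>2 \<noteq> 0"
    using ab ac unfolding d_def e_def f_def g_def by (auto simp: sum_power2_eq_zero_iff)
  define t where "t = (f * d + g * e) / (d\<^sup>2 + e\<^sup>2)"
  have f: "f = t * d"
  proof -
    have "f * (d\<^sup>2 + e\<^sup>2) = (f * d + g * e) * d" using 1 by algebra
    then show ?thesis using nz(1) unfolding t_def by (simp add: field_simps)
  qed
  have g: "g = t * e"
  proof -
    have "g * (d\<^sup>2 + e\<^sup>2) = (f * d + g * e) * e" using 1 by algebra
    then show ?thesis using nz(1) unfolding t_def by (simp add: field_simps)
  qed
  have "t * (t - 1) * (d\<^sup>2 + e\<^sup>2) = 0"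
    using d unfolding f g by algebra
  then have "t = 0 \<or> t = 1" using nz by auto
  then show False
  proof
    assume "t = 0" then show False using nz(2) f g by simp
  next
    assume "t = 1" then show False using bc f g unfolding d_def e_def f_def g_def by auto
  qed
qed

text \<open>A new vertex is placed above the point \<open>(1, k) / sqrt (1 + k\<^sup>2)\<close> of the unit circle, at
  height \<open>h\<close>. Up to the positive scalar, the bar equations are then polynomial in \<open>k\<close> and \<open>h\<close>.\<close>

definition circle_scale :: "real \<Rightarrow> real" where
  "circle_scale k = 1 / sqrt (1 + k\<^sup>2)"

definition bar :: "real \<Rightarrow> real \<Rightarrow> real \<Rightarrow> real \<Rightarrow> real \<Rightarrow> real \<Rightarrow> real \<Rightarrow> real" where
  "bar k h x y z \<alpha> \<zeta> = circle_scale k * (k * x - y) * \<alpha> + (h - z) * \<zeta>"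

lemma circle_scale_nonzero: "circle_scale k \<noteq> 0"
proof -
  have "1 + k\<^sup>2 > 0" by (simp add: add_pos_nonneg)
  then show ?thesis by (simp add: circle_scale_def)
qed

lemma circle_scale_on_circle: "(circle_scale k)\<^sup>2 + (k * circle_scale k)\<^sup>2 = 1"
proof -
  have p: "1 + k\<^sup>2 > 0" by (simp add: add_pos_nonneg)
  then have "(circle_scale k)\<^sup>2 = 1 / (1 + k\<^sup>2)" by (simp add: circle_scale_def power_divide)
  then have "(circle_scale k)\<^sup>2 * (1 + k\<^sup>2) = 1" using p by simp
  then show ?thesis by (simp add: power_mult_distrib algebra_simps)
qed

lemma eventually_slope_neq_0:
  fixes x y :: real
  assumes "x\<^sup>2 + y\<^sup>2 = 1"
  shows "\<forall>\<^sub>F k in cofinite. k * x - y \<noteq> 0"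
proof -
  have "- y \<noteq> 0 \<or> x \<noteq> 0" using assms by auto
  then have "\<forall>\<^sub>F k in cofinite. - y + x * k \<noteq> 0" by (rule eventually_linear_neq_0)
  then show ?thesis by (rule eventually_mono) (simp add: algebra_simps)
qed

text \<open>The direction \<open>k\<close> is chosen first, and the exceptional heights may depend
  on it. For \<open>k\<close> not parallel to the joint, the bar is affine in \<open>h\<close> with
  slope \<zeta>, and if \<zeta> is zero it is a nonzero multiple of \<alpha>.\<close>

lemma one_bar:
  assumes "x\<^sup>2 + y\<^sup>2 = 1" and nz: "\<alpha> \<noteq> 0 \<or> \<zeta> \<noteq> 0"
  shows "\<forall>\<^sub>F k in cofinite. \<forall>\<^sub>F h in cofinite. bar k h x y z \<alpha> \<zeta> \<noteq> 0"
  using eventually_slope_neq_0[OF assms(1)]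
proof (rule eventually_mono)
  fix k assume k: "k * x - y \<noteq> 0"
  define R where "R = circle_scale k * (k * x - y)"
  have R: "R \<noteq> 0" using k circle_scale_nonzero by (simp add: R_def)
  have "\<forall>\<^sub>F h in cofinite. (R * \<alpha> - z * \<zeta>) + \<zeta> * h \<noteq> 0"
    by (rule eventually_linear_neq_0) (use nz R in auto)
  moreover have "bar k h x y z \<alpha> \<zeta> = (R * \<alpha> - z * \<zeta>) + \<zeta> * h" for h
    by (simp add: bar_def R_def algebra_simps)
  ultimately show "\<forall>\<^sub>F h in cofinite. bar k h x y z \<alpha> \<zeta> \<noteq> 0" by simp
qed

text \<open>The determinant of the two equations is affine in \<open>h\<close>. Its slope
  \<open>Ra - Rb\<close> is nonzero for generic \<open>k\<close>, since the joints lie above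
  different points of the circle.\<close>

lemma two_bars:
  assumes "xa \<noteq> xb \<or> ya \<noteq> yb"
  shows "\<forall>\<^sub>F k in cofinite. \<forall>\<^sub>F h in cofinite. \<forall>\<alpha> \<zeta>.
    bar k h xa ya za \<alpha> \<zeta> = 0 \<and> bar k h xb yb zb \<alpha> \<zeta> = 0 \<longrightarrow> \<alpha> = 0 \<and> \<zeta> = 0"
proof -
  have "\<forall>\<^sub>F k in cofinite. (yb - ya) + (xa - xb) * k \<noteq> 0"
    by (rule eventually_linear_neq_0) (use assms in auto)
  then show ?thesis
  proof (rule eventually_mono)
    fix k assume k: "(yb - ya) + (xa - xb) * k \<noteq> 0"
    define Ra Rb where "Ra = circle_scale k * (k * xa - ya)" and "Rb = circle_scale k * (k * xb - yb)"
    have "Ra - Rb = circle_scale k * ((yb - ya) + (xa - xb) * k)"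
      by (simp add: Ra_def Rb_def algebra_simps)
    then have R: "Ra - Rb \<noteq> 0" using k circle_scale_nonzero by simp
    have "\<forall>\<^sub>F h in cofinite. (Rb * za - Ra * zb) + (Ra - Rb) * h \<noteq> 0"
      by (rule eventually_linear_neq_0) (use R in auto)
    then show "\<forall>\<^sub>F h in cofinite. \<forall>\<alpha> \<zeta>.
        bar k h xa ya za \<alpha> \<zeta> = 0 \<and> bar k h xb yb zb \<alpha> \<zeta> = 0 \<longrightarrow> \<alpha> = 0 \<and> \<zeta> = 0"
    proof (rule eventually_mono, intro allI impI)
      fix h \<alpha> \<zeta>
      assume h: "(Rb * za - Ra * zb) + (Ra - Rb) * h \<noteq> 0"
        and "bar k h xa ya za \<alpha> \<zeta> = 0 \<and> bar k h xb yb zb \<alpha> \<zeta> = 0"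
      then have eq: "Ra * \<alpha> + (h - za) * \<zeta> = 0" "Rb * \<alpha> + (h - zb) * \<zeta> = 0"
        by (auto simp: bar_def Ra_def Rb_def)
      have "((Rb * za - Ra * zb) + (Ra - Rb) * h) * \<alpha> = 0"
           "((Rb * za - Ra * zb) + (Ra - Rb) * h) * \<zeta> = 0"
        using eq by algebra+
      then show "\<alpha> = 0 \<and> \<zeta> = 0" using h by auto
    qed
  qed
qed

text \<open>A velocity assignment on three joints that is not rigid extends to a fourth joint only in
  special position: the solvability determinant is a polynomial in \<open>h\<close> whose coefficient of
  \<open>h\<^sup>2\<close> (or of \<open>h\<close>, if \<open>\<zeta>\<close> is constant) does not vanish identically in \<open>k\<close>.\<close>

lemma three_bars:
  fixes xa ya za xb yb zb xc yc zc :: real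
  assumes circ: "xa\<^sup>2 + ya\<^sup>2 = 1" "xb\<^sup>2 + yb\<^sup>2 = 1" "xc\<^sup>2 + yc\<^sup>2 = 1"
    and sab: "ya * xb - xa * yb \<noteq> 0" and sac: "ya * xc - xa * yc \<noteq> 0"
    and bc: "xb \<noteq> xc \<or> yb \<noteq> yc"
    and nc: "\<not> (\<alpha>a = \<alpha>b \<and> \<alpha>b = \<alpha>c \<and> \<zeta>a = \<zeta>b \<and> \<zeta>b = \<zeta>c)"
  shows "\<forall>\<^sub>F k in cofinite. \<forall>\<^sub>F h in cofinite. \<forall>A B.
    \<not> (bar k h xa ya za (A - \<alpha>a) (B - \<zeta>a) = 0 \<and> bar k h xb yb zb (A - \<alpha>b) (B - \<zeta>b) = 0 \<and>
       bar k h xc yc zc (A - \<alpha>c) (B - \<zeta>c) = 0)"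
proof (cases "\<zeta>a = \<zeta>b \<and> \<zeta>b = \<zeta>c")
  case False
  \<comment> \<open>The leading coefficient of the determinant below is a nonzero multiple of
    \<open>- Y + X * k\<close>. If \<open>X\<close> and \<open>Y\<close> both vanished, either the
    three points of the circle would be collinear or \<zeta> would be constant on them.\<close>
  define X Y where "X = xa * (\<zeta>c - \<zeta>b) + xb * (\<zeta>a - \<zeta>c) + xc * (\<zeta>b - \<zeta>a)"
    and "Y = ya * (\<zeta>c - \<zeta>b) + yb * (\<zeta>a - \<zeta>c) + yc * (\<zeta>b - \<zeta>a)"
  have "- Y \<noteq> 0 \<or> X \<noteq> 0"
  proof (rule ccontr)
    assume "\<not> ?thesis"
    then have XY: "X = 0" "Y = 0" by auto
    have "((xb - xa) * (yc - ya) - (xc - xa) * (yb - ya)) * (\<zeta>b - \<zeta>a) = 0"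
      "((xb - xa) * (yc - ya) - (xc - xa) * (yb - ya)) * (\<zeta>c - \<zeta>a) = 0"
      using XY unfolding X_def Y_def by algebra+
    moreover have "(xb - xa) * (yc - ya) - (xc - xa) * (yb - ya) \<noteq> 0"
      by (rule circle_not_collinear[OF circ]) (use sab sac bc in auto)
    ultimately show False using False by auto
  qed
  then have "\<forall>\<^sub>F k in cofinite. - Y + X * k \<noteq> 0" by (rule eventually_linear_neq_0)
  then show ?thesis
  proof (rule eventually_mono)
    fix k assume k: "- Y + X * k \<noteq> 0"
    define Ra Rb Rc where "Ra = circle_scale k * (k * xa - ya)"
      and "Rb = circle_scale k * (k * xb - yb)" and "Rc = circle_scale k * (k * xc - yc)"
    define W where "W h R z \<alpha> \<zeta> = R * \<alpha> + (h - z) * \<zeta>" for h R z \<alpha> \<zeta> :: real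
    \<comment> \<open>This is the determinant of the augmented system: the three bars read
      \<open>R * A + (h - z) * B = W\<close>, and a solution \<open>A\<close>, \<open>B\<close>
      makes the third column a combination of the other two.\<close>
    define f where "f h = Ra * ((h - zb) * W h Rc zc \<alpha>c \<zeta>c - (h - zc) * W h Rb zb \<alpha>b \<zeta>b)
      - (h - za) * (Rb * W h Rc zc \<alpha>c \<zeta>c - Rc * W h Rb zb \<alpha>b \<zeta>b)
      + W h Ra za \<alpha>a \<zeta>a * (Rb * (h - zc) - Rc * (h - zb))" for h
    define q where "q = circle_scale k * (- Y + X * k)"
    have q: "q = Ra * (\<zeta>c - \<zeta>b) + Rb * (\<zeta>a - \<zeta>c) + Rc * (\<zeta>b - \<zeta>a)"
      unfolding q_def Ra_def Rb_def Rc_def X_def Y_def by (simp add: algebra_simps)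
    \<comment> \<open>A quadratic with leading coefficient \<open>q\<close>; its middle coefficient
      is read off from the values at 0 and 1.\<close>
    have f: "f h = f 0 + (f 1 - f 0 - q) * h + q * h\<^sup>2" for h
      unfolding f_def W_def q by (simp add: algebra_simps power2_eq_square)
    have "\<forall>\<^sub>F h in cofinite. f 0 + (f 1 - f 0 - q) * h + q * h\<^sup>2 \<noteq> 0"
      by (rule eventually_quadratic_neq_0) (use k circle_scale_nonzero q_def in auto)
    then have "\<forall>\<^sub>F h in cofinite. f h \<noteq> 0" by (subst f)
    then show "\<forall>\<^sub>F h in cofinite. \<forall>A B.
      \<not> (bar k h xa ya za (A - \<alpha>a) (B - \<zeta>a) = 0 \<and> bar k h xb yb zb (A - \<alpha>b) (B - \<zeta>b) = 0 \<and>
       bar k h xc yc zc (A - \<alpha>c) (B - \<zeta>c) = 0)"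
    proof (rule eventually_mono, intro allI notI)
      fix h A B
      assume h: "f h \<noteq> 0"
        and "bar k h xa ya za (A - \<alpha>a) (B - \<zeta>a) = 0 \<and> bar k h xb yb zb (A - \<alpha>b) (B - \<zeta>b) = 0 \<and>
          bar k h xc yc zc (A - \<alpha>c) (B - \<zeta>c) = 0"
      then have "Ra * (A - \<alpha>a) + (h - za) * (B - \<zeta>a) = 0" "Rb * (A - \<alpha>b) + (h - zb) * (B - \<zeta>b) = 0"
        "Rc * (A - \<alpha>c) + (h - zc) * (B - \<zeta>c) = 0"
        by (simp_all add: bar_def Ra_def Rb_def Rc_def)
      then have "W h Ra za \<alpha>a \<zeta>a = Ra * A + (h - za) * B" "W h Rb zb \<alpha>b \<zeta>b = Rb * A + (h - zb) * B"
        "W h Rc zc \<alpha>c \<zeta>c = Rc * A + (h - zc) * B"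
        unfolding W_def right_diff_distrib
        by linarith+
      then have "f h = 0" unfolding f_def by (simp only:) (simp add: algebra_simps)
      then show False using h by simp
    qed
  qed
next
  case True
  \<comment> \<open>As \<zeta> is constant here, measuring velocities relative to the joint
    \<open>b\<close> leaves the right-hand sides \<open>Ra * a\<close>, 0 and
    \<open>Rc * c\<close>.\<close>
  define a c where "a = \<alpha>a - \<alpha>b" and "c = \<alpha>c - \<alpha>b"
  have ac: "a \<noteq> 0 \<or> c \<noteq> 0" using nc True by (auto simp: a_def c_def)
  define Q\<^sub>0 Q\<^sub>1 Q\<^sub>2 where
    "Q\<^sub>0 = c * yc * (ya - yb) + a * ya * (yb - yc)"
    and "Q\<^sub>1 = - c * (xc * (ya - yb) + yc * (xa - xb)) - a * (xa * (yb - yc) + ya * (xb - xc))"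
    and "Q\<^sub>2 = c * xc * (xa - xb) + a * xa * (xb - xc)"
  have Q: "Q\<^sub>0 + Q\<^sub>1 * k + Q\<^sub>2 * k\<^sup>2 = (k * xc - yc) * c * ((k * xa - ya) - (k * xb - yb))
      + (k * xa - ya) * a * ((k * xb - yb) - (k * xc - yc))" for k
    unfolding Q\<^sub>0_def Q\<^sub>1_def Q\<^sub>2_def by (simp add: algebra_simps power2_eq_square)
  have "\<forall>\<^sub>F k in cofinite. Q\<^sub>0 + Q\<^sub>1 * k + Q\<^sub>2 * k\<^sup>2 \<noteq> 0"
  proof (cases "c = 0")
    case False
    show ?thesis
    proof (rule eventually_quadratic_neq_0, rule ccontr)
      assume "\<not> (Q\<^sub>0 \<noteq> 0 \<or> Q\<^sub>1 \<noteq> 0 \<or> Q\<^sub>2 \<noteq> 0)"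
      \<comment> \<open>The homogenised quadratic is evaluated in the direction of the joint
        \<open>a\<close>, that is at the slope \<open>ya / xa\<close> without division. There the
        factor \<open>k * xa - ya\<close> vanishes and only one product survives.\<close>
      then have "Q\<^sub>0 * xa\<^sup>2 + Q\<^sub>1 * xa * ya + Q\<^sub>2 * ya\<^sup>2 = 0" by simp
      moreover have "Q\<^sub>0 * xa\<^sup>2 + Q\<^sub>1 * xa * ya + Q\<^sub>2 * ya\<^sup>2
          = - c * (ya * xb - xa * yb) * (ya * xc - xa * yc)"
        unfolding Q\<^sub>0_def Q\<^sub>1_def Q\<^sub>2_def by (simp add: algebra_simps power2_eq_square)
      ultimately show False using False sab sac by simp
    qed
  next
    case True
    have "\<forall>\<^sub>F k in cofinite. (yc - yb) + (xb - xc) * k \<noteq> 0"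
      by (rule eventually_linear_neq_0) (use bc in auto)
    with eventually_slope_neq_0[OF circ(1)] show ?thesis
    proof eventually_elim
      case (elim k)
      have "Q\<^sub>0 + Q\<^sub>1 * k + Q\<^sub>2 * k\<^sup>2 = a * (k * xa - ya) * ((yc - yb) + (xb - xc) * k)"
        unfolding Q using True by (simp add: algebra_simps)
      then show ?case using elim True ac by simp
    qed
  qed
  then show ?thesis
  proof (rule eventually_mono)
    fix k assume k: "Q\<^sub>0 + Q\<^sub>1 * k + Q\<^sub>2 * k\<^sup>2 \<noteq> 0"
    define Ra Rb Rc where "Ra = circle_scale k * (k * xa - ya)"
      and "Rb = circle_scale k * (k * xb - yb)" and "Rc = circle_scale k * (k * xc - yc)"
    \<comment> \<open>The augmented determinant again, now with the relative right-hand sides. The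
      terms in the square of \<open>h\<close> have gone, and \<open>q\<close> is the slope.\<close>
    define f where "f h = Ra * ((h - zb) * (Rc * c)) - (h - za) * (Rb * (Rc * c))
      + Ra * a * (Rb * (h - zc) - Rc * (h - zb))" for h
    define q where "q = circle_scale k * circle_scale k * (Q\<^sub>0 + Q\<^sub>1 * k + Q\<^sub>2 * k\<^sup>2)"
    have q: "q = Rc * c * (Ra - Rb) + Ra * a * (Rb - Rc)"
      unfolding q_def Q Ra_def Rb_def Rc_def by (simp add: algebra_simps)
    have f: "f h = f 0 + q * h" for h
      unfolding f_def q by (simp add: algebra_simps)
    have "\<forall>\<^sub>F h in cofinite. f 0 + q * h \<noteq> 0"
      by (rule eventually_linear_neq_0) (use k circle_scale_nonzero q_def in auto)
    then have "\<forall>\<^sub>F h in cofinite. f h \<noteq> 0" by (subst f)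
    then show "\<forall>\<^sub>F h in cofinite. \<forall>A B.
      \<not> (bar k h xa ya za (A - \<alpha>a) (B - \<zeta>a) = 0 \<and> bar k h xb yb zb (A - \<alpha>b) (B - \<zeta>b) = 0 \<and>
       bar k h xc yc zc (A - \<alpha>c) (B - \<zeta>c) = 0)"
    proof (rule eventually_mono, intro allI notI)
      fix h A B
      assume h: "f h \<noteq> 0"
        and eq: "bar k h xa ya za (A - \<alpha>a) (B - \<zeta>a) = 0 \<and> bar k h xb yb zb (A - \<alpha>b) (B - \<zeta>b) = 0 \<and>
          bar k h xc yc zc (A - \<alpha>c) (B - \<zeta>c) = 0"
      define A' B' where "A' = A - \<alpha>b" and "B' = B - \<zeta>b"
      have "Ra * (A' - a) + (h - za) * B' = 0" "Rb * A' + (h - zb) * B' = 0"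
        "Rc * (A' - c) + (h - zc) * B' = 0"
        using eq True unfolding bar_def Ra_def Rb_def Rc_def A'_def B'_def a_def c_def by auto
      then have "Ra * a = Ra * A' + (h - za) * B'" "(h - zb) * B' = - (Rb * A')"
        "Rc * c = Rc * A' + (h - zc) * B'"
        unfolding right_diff_distrib by linarith+
      then have "f h = 0" unfolding f_def by algebra
      then show False using h by simp
    qed
  qed
qed

section \<open>Extending rigid placements\<close>

lemma bond_motion_subset:
  "bond_motion V \<mu> x y z \<alpha> \<zeta> \<Longrightarrow> W \<subseteq> V \<Longrightarrow> bond_motion W \<mu> x y z \<alpha> \<zeta>"
  unfolding bond_motion_def by blast

lemma bond_motion_cong:
  assumes "\<And>v. v \<in> V \<Longrightarrow> x v = x' v \<and> y v = y' v \<and> z v = z' v"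
  shows "bond_motion V \<mu> x y z \<alpha> \<zeta> \<longleftrightarrow> bond_motion V \<mu> x' y' z' \<alpha> \<zeta>"
  unfolding bond_motion_def by (intro ball_cong refl) (simp add: assms)

lemma bond_motion_combine:
  assumes "bond_motion V \<mu> x y z \<alpha> \<zeta>" "bond_motion V \<mu> x y z \<alpha>' \<zeta>'"
  shows "bond_motion V \<mu> x y z (\<lambda>v. \<alpha> v + c * \<alpha>' v) (\<lambda>v. \<zeta> v + c * \<zeta>' v)"
  unfolding bond_motion_def
proof (intro ballI conjI impI)
  fix u w assume uw: "u \<in> V" "w \<in> V"
  { assume "\<mu> u w = 1"
    then have "(y u * x w - x u * y w) * (\<alpha> u - \<alpha> w) + (z u - z w) * (\<zeta> u - \<zeta> w) = 0"
      "(y u * x w - x u * y w) * (\<alpha>' u - \<alpha>' w) + (z u - z w) * (\<zeta>' u - \<zeta>' w) = 0"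
      using assms uw unfolding bond_motion_def by blast+
    then show "(y u * x w - x u * y w) * (\<alpha> u + c * \<alpha>' u - (\<alpha> w + c * \<alpha>' w))
        + (z u - z w) * (\<zeta> u + c * \<zeta>' u - (\<zeta> w + c * \<zeta>' w)) = 0"
      by algebra }
  assume "2 \<le> \<mu> u w"
  then have "\<alpha> u = \<alpha> w" "\<zeta> u = \<zeta> w" "\<alpha>' u = \<alpha>' w" "\<zeta>' u = \<zeta>' w"
    using assms uw unfolding bond_motion_def by blast+
  then show "\<alpha> u + c * \<alpha>' u = \<alpha> w + c * \<alpha>' w" "\<zeta> u + c * \<zeta>' u = \<zeta> w + c * \<zeta>' w" by simp_all
qed

lemma has_parity_combine:
  assumes "has_parity V \<theta> \<sigma> \<alpha> \<zeta>" "has_parity V \<theta> \<sigma> \<alpha>' \<zeta>'"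
  shows "has_parity V \<theta> \<sigma> (\<lambda>v. \<alpha> v + c * \<alpha>' v) (\<lambda>v. \<zeta> v + c * \<zeta>' v)"
  using assms unfolding has_parity_def by (simp add: algebra_simps)

lemma sym_placementD:
  assumes "sym_placement V \<theta> x y z"
  shows "v \<in> V \<Longrightarrow> (x v)\<^sup>2 + (y v)\<^sup>2 = 1"
    and "v \<in> V \<Longrightarrow> x (\<theta> v) = - x v" and "v \<in> V \<Longrightarrow> y (\<theta> v) = - y v" and "v \<in> V \<Longrightarrow> z (\<theta> v) = - z v"
    and "u \<in> V \<Longrightarrow> w \<in> V \<Longrightarrow> w \<noteq> u \<Longrightarrow> w \<noteq> \<theta> u \<Longrightarrow> y u * x w - x u * y w \<noteq> 0"
  using assms unfolding sym_placement_def by blast+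

lemma sym_placement_distinct:
  assumes P: "sym_placement V \<theta> x y z" and uw: "u \<in> V" "w \<in> V" "u \<noteq> w"
  shows "x u \<noteq> x w \<or> y u \<noteq> y w"
proof (cases "w = \<theta> u")
  case True
  then show ?thesis using sym_placementD(1-3)[OF P uw(1)] by auto
next
  case False
  then show ?thesis using sym_placementD(5)[OF P uw(1,2)] uw(3) by auto
qed

text \<open>\<open>three_bars\<close> wants its first joint in a different orbit from the other two.
  Orbits have two elements, so one of three distinct joints always qualifies, and a relabelling
  suffices.\<close>

lemma three_bars_placement:
  assumes G: "sym_multigraph V \<theta> \<mu>" and P: "sym_placement V \<theta> x y z"
    and abc: "a \<in> V" "b \<in> V" "c \<in> V" "a \<noteq> b" "a \<noteq> c" "b \<noteq> c"
    and nc: "\<not> (\<alpha> a = \<alpha> b \<and> \<alpha> b = \<alpha> c \<and> \<zeta> a = \<zeta> b \<and> \<zeta> b = \<zeta> c)"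
  shows "\<forall>\<^sub>F k in cofinite. \<forall>\<^sub>F h in cofinite. \<forall>A B.
    \<not> (\<forall>w\<in>{a, b, c}. bar k h (x w) (y w) (z w) (A - \<alpha> w) (B - \<zeta> w) = 0)"
proof -
  have T: "\<theta> v \<in> V" "\<theta> (\<theta> v) = v" if "v \<in> V" for v
    using sym_multigraphD(2,3)[OF G that] by auto
  have main: ?thesis if p: "{p, q, r} = {a, b, c}" "p \<noteq> q" "p \<noteq> r" "q \<noteq> r" "q \<noteq> \<theta> p" "r \<noteq> \<theta> p" for p q r
  proof -
    have V: "p \<in> V" "q \<in> V" "r \<in> V" using p(1) abc by auto
    have nc': "\<not> (\<alpha> p = \<alpha> q \<and> \<alpha> q = \<alpha> r \<and> \<zeta> p = \<zeta> q \<and> \<zeta> q = \<zeta> r)"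
    proof
      assume "\<alpha> p = \<alpha> q \<and> \<alpha> q = \<alpha> r \<and> \<zeta> p = \<zeta> q \<and> \<zeta> q = \<zeta> r"
      then have "\<forall>v\<in>{p, q, r}. \<alpha> v = \<alpha> p \<and> \<zeta> v = \<zeta> p" by auto
      then show False using nc unfolding p(1) by auto
    qed
    have "\<forall>\<^sub>F k in cofinite. \<forall>\<^sub>F h in cofinite. \<forall>A B.
      \<not> (bar k h (x p) (y p) (z p) (A - \<alpha> p) (B - \<zeta> p) = 0 \<and> bar k h (x q) (y q) (z q) (A - \<alpha> q) (B - \<zeta> q) = 0 \<and>
        bar k h (x r) (y r) (z r) (A - \<alpha> r) (B - \<zeta> r) = 0)"
      using sym_placementD(1)[OF P V(1)] sym_placementD(1)[OF P V(2)] sym_placementD(1)[OF P V(3)]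
        sym_placementD(5)[OF P V(1,2) p(2)[symmetric] p(5)]
        sym_placementD(5)[OF P V(1,3) p(3)[symmetric] p(6)]
        sym_placement_distinct[OF P V(2,3) p(4)] nc'
      by (rule three_bars)
    then show ?thesis unfolding p(1)[symmetric] by simp
  qed
  show ?thesis
  proof (cases "b = \<theta> a")
    case True
    have "a \<noteq> \<theta> c" "b \<noteq> \<theta> c" using True T abc by metis+
    then show ?thesis using main[of c a b] abc by auto
  next
    case b: False
    show ?thesis
    proof (cases "c = \<theta> a")
      case True
      have "a \<noteq> \<theta> b" "c \<noteq> \<theta> b" using True T abc by metis+
      then show ?thesis using main[of b a c] abc by auto
    next
      case False
      then show ?thesis using main[of a b c] b abc by auto
    qed
  qed
qed

definition joint_motion ::
  "'a set \<Rightarrow> ('a \<Rightarrow> 'a \<Rightarrow> nat) \<Rightarrow> 'a \<Rightarrow> ('a \<Rightarrow> real) \<Rightarrow> ('a \<Rightarrow> real) \<Rightarrow> ('a \<Rightarrow> real) \<Rightarrow> real \<Rightarrow> real \<Rightarrow> ('a \<Rightarrow> real) \<Rightarrow> ('a \<Rightarrow> real) \<Rightarrow> bool"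
  where "joint_motion W \<mu> v x y z k h \<alpha> \<zeta> \<longleftrightarrow> (\<forall>w\<in>W.
     (\<mu> v w = 1 \<longrightarrow> bar k h (x w) (y w) (z w) (\<alpha> v - \<alpha> w) (\<zeta> v - \<zeta> w) = 0) \<and>
     (2 \<le> \<mu> v w \<longrightarrow> \<alpha> v = \<alpha> w \<and> \<zeta> v = \<zeta> w))"

text \<open>Only \<open>v\<close> is placed, and \<open>\<theta> v\<close> goes to the antipode. The
  conditions for both parities and for nonparallel directions hold for generic \<open>k\<close> and
  then generic \<open>h\<close>, so they have a common choice.\<close>

lemma extend_placement:
  assumes G: "sym_multigraph V \<theta> \<mu>" and v: "v \<in> V" and W: "W = V - {v, \<theta> v}" "W \<noteq> {}"
    and P: "sym_placement W \<theta> x y z"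
    and rig: "\<And>\<sigma>. \<sigma> \<in> {1, -1} \<Longrightarrow> \<forall>\<^sub>F k in cofinite. \<forall>\<^sub>F h in cofinite. \<forall>\<alpha> \<zeta>.
      bond_motion W \<mu> x y z \<alpha> \<zeta> \<longrightarrow> has_parity V \<theta> \<sigma> \<alpha> \<zeta> \<longrightarrow> joint_motion W \<mu> v x y z k h \<alpha> \<zeta> \<longrightarrow>
      (2 \<le> \<mu> v (\<theta> v) \<longrightarrow> \<alpha> v = \<alpha> (\<theta> v) \<and> \<zeta> v = \<zeta> (\<theta> v)) \<longrightarrow>
      (\<exists>A B. \<forall>w\<in>insert v W. \<alpha> w = A \<and> \<zeta> w = B)"
  shows "\<exists>x y z. sym_placement V \<theta> x y z \<and> parity_rigid V \<theta> \<mu> x y z"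
proof -
  have T: "\<theta> v \<in> V" "\<theta> (\<theta> v) = v" "\<theta> v \<noteq> v" if "v \<in> V" for v
    using sym_multigraphD(2-4)[OF G that] by auto
  have fin: "finite W" using sym_multigraphD(1)[OF G] W by simp
  have tW: "\<theta> ` W = W" by (rule degree_sum_remove_orbit(3)[OF G v W(1)])
  have V: "V = insert v (insert (\<theta> v) W)" using W v T[OF v] by auto
  have nW: "v \<notin> W" "\<theta> v \<notin> W" using W by auto
  have cofinite: "(cofinite :: real filter) \<noteq> bot"
    using infinite_UNIV_char_0[where ?'a = real] by (simp add: cofinite_bot)
  have "\<forall>\<^sub>F k in cofinite. \<forall>w\<in>W. k * x w - y w \<noteq> 0"
    using fin by (intro eventually_ball_finite ballI eventually_slope_neq_0 sym_placementD(1)[OF P])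
  moreover have "1 \<in> {1, -1::real}" "- 1 \<in> {1, -1::real}" by auto
  note rig[OF this(1)] rig[OF this(2)]
  ultimately have "\<forall>\<^sub>F k in cofinite. (\<forall>w\<in>W. k * x w - y w \<noteq> 0) \<and> (\<forall>\<^sub>F h in cofinite. \<forall>\<sigma>\<in>{1, -1}. \<forall>\<alpha> \<zeta>.
      bond_motion W \<mu> x y z \<alpha> \<zeta> \<longrightarrow> has_parity V \<theta> \<sigma> \<alpha> \<zeta> \<longrightarrow> joint_motion W \<mu> v x y z k h \<alpha> \<zeta> \<longrightarrow>
      (2 \<le> \<mu> v (\<theta> v) \<longrightarrow> \<alpha> v = \<alpha> (\<theta> v) \<and> \<zeta> v = \<zeta> (\<theta> v)) \<longrightarrow>
      (\<exists>A B. \<forall>w\<in>insert v W. \<alpha> w = A \<and> \<zeta> w = B))"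
    by eventually_elim (simp add: eventually_conj_iff)
  from eventually_happens'[OF cofinite this] obtain k where slope: "\<And>w. w \<in> W \<Longrightarrow> k * x w - y w \<noteq> 0"
    and "\<forall>\<^sub>F h in cofinite. \<forall>\<sigma>\<in>{1, -1}. \<forall>\<alpha> \<zeta>.
      bond_motion W \<mu> x y z \<alpha> \<zeta> \<longrightarrow> has_parity V \<theta> \<sigma> \<alpha> \<zeta> \<longrightarrow> joint_motion W \<mu> v x y z k h \<alpha> \<zeta> \<longrightarrow>
      (2 \<le> \<mu> v (\<theta> v) \<longrightarrow> \<alpha> v = \<alpha> (\<theta> v) \<and> \<zeta> v = \<zeta> (\<theta> v)) \<longrightarrow>
      (\<exists>A B. \<forall>w\<in>insert v W. \<alpha> w = A \<and> \<zeta> w = B)"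
    by blast
  from eventually_happens'[OF cofinite this(2)] obtain h where rg: "\<And>\<sigma> \<alpha> \<zeta>. \<sigma> \<in> {1, -1} \<Longrightarrow>
      bond_motion W \<mu> x y z \<alpha> \<zeta> \<Longrightarrow> has_parity V \<theta> \<sigma> \<alpha> \<zeta> \<Longrightarrow> joint_motion W \<mu> v x y z k h \<alpha> \<zeta> \<Longrightarrow>
      (2 \<le> \<mu> v (\<theta> v) \<longrightarrow> \<alpha> v = \<alpha> (\<theta> v) \<and> \<zeta> v = \<zeta> (\<theta> v)) \<Longrightarrow>
      (\<exists>A B. \<forall>w\<in>insert v W. \<alpha> w = A \<and> \<zeta> w = B)"
    by blast
  let ?s = "circle_scale k"
  define x' y' z' where "x' = x(v := ?s, \<theta> v := - ?s)" and "y' = y(v := k * ?s, \<theta> v := - (k * ?s))"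
    and "z' = z(v := h, \<theta> v := - h)"
  have xW: "x' w = x w" "y' w = y w" "z' w = z w" if "w \<in> W" for w
    using that nW unfolding x'_def y'_def z'_def by auto
  have xv: "x' v = ?s" "y' v = k * ?s" "z' v = h" "x' (\<theta> v) = - ?s" "y' (\<theta> v) = - (k * ?s)" "z' (\<theta> v) = - h"
    using T(3)[OF v] unfolding x'_def y'_def z'_def by auto
  have "sym_placement V \<theta> x' y' z'"
    unfolding sym_placement_def
  proof (intro conjI ballI impI)
    fix u assume u: "u \<in> V"
    have "u \<in> W \<Longrightarrow> \<theta> u \<in> W" using tW by auto
    then show "(x' u)\<^sup>2 + (y' u)\<^sup>2 = 1" "x' (\<theta> u) = - x' u" "y' (\<theta> u) = - y' u" "z' (\<theta> u) = - z' u"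
      using u sym_placementD(1-4)[OF P, of u] xv xW T(2)[OF v] circle_scale_on_circle[of k]
      unfolding V by auto
    fix w assume w: "w \<in> V" and uw: "w \<noteq> u \<and> w \<noteq> \<theta> u"
    have eq: "k * ?s * x w - ?s * y w = ?s * (k * x w - y w)" for w by (simp add: algebra_simps)
    have 1: "k * ?s * x w - ?s * y w \<noteq> 0" if "w \<in> W" for w
      unfolding eq using slope[OF that] circle_scale_nonzero by simp
    consider "u \<in> W" "w \<in> W" | "u = v" "w \<in> W" | "u = \<theta> v" "w \<in> W" | "u \<in> W" "w = v" | "u \<in> W" "w = \<theta> v"
      using u w uw T(2)[OF v] unfolding V by auto
    then show "y' u * x' w - x' u * y' w \<noteq> 0"
    proof cases
      case 1
      then show ?thesis using sym_placementD(5)[OF P, of u w] xW uw by auto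
    qed (use 1[of u] 1[of w] xW xv in \<open>auto simp: algebra_simps\<close>)
  qed
  moreover have "parity_rigid V \<theta> \<mu> x' y' z'"
    unfolding parity_rigid_def
  proof (intro ballI allI impI)
    fix \<sigma> :: real and \<alpha> \<zeta> assume s: "\<sigma> \<in> {1, -1}" and "bond_motion V \<mu> x' y' z' \<alpha> \<zeta> \<and> has_parity V \<theta> \<sigma> \<alpha> \<zeta>"
    then have m: "bond_motion V \<mu> x' y' z' \<alpha> \<zeta>" and par: "has_parity V \<theta> \<sigma> \<alpha> \<zeta>" by auto
    have mW: "bond_motion W \<mu> x y z \<alpha> \<zeta>"
      using bond_motion_subset[OF m, of W] bond_motion_cong[of W x' x y' y z' z] xW V by auto
    have "joint_motion W \<mu> v x y z k h \<alpha> \<zeta>"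
      unfolding joint_motion_def
    proof (intro ballI conjI impI)
      fix w assume w: "w \<in> W"
      then have wV: "w \<in> V" using V by auto
      { assume "\<mu> v w = 1"
        then have "(y' v * x' w - x' v * y' w) * (\<alpha> v - \<alpha> w) + (z' v - z' w) * (\<zeta> v - \<zeta> w) = 0"
          using m v wV unfolding bond_motion_def by blast
        then show "bar k h (x w) (y w) (z w) (\<alpha> v - \<alpha> w) (\<zeta> v - \<zeta> w) = 0"
          unfolding bar_def xv xW[OF w] by (simp add: algebra_simps) }
      assume "2 \<le> \<mu> v w"
      then show "\<alpha> v = \<alpha> w" "\<zeta> v = \<zeta> w" using m v wV unfolding bond_motion_def by blast+
    qed
    moreover have "2 \<le> \<mu> v (\<theta> v) \<longrightarrow> \<alpha> v = \<alpha> (\<theta> v) \<and> \<zeta> v = \<zeta> (\<theta> v)"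
      using m v T(1)[OF v] unfolding bond_motion_def by blast
    ultimately obtain A B where AB: "\<And>w. w \<in> insert v W \<Longrightarrow> \<alpha> w = A \<and> \<zeta> w = B"
      using rg[OF s mW par] by blast
    \<comment> \<open>Comparing some \<open>w\<close> with \<open>\<theta> w\<close> shows that the
      constants themselves obey the parity, whence \<open>\<theta> v\<close> takes the same values
      as \<open>v\<close>.\<close>
    obtain w where w: "w \<in> W" using W by auto
    then have "w \<in> V" "\<theta> w \<in> W" using V tW by auto
    then have "A = \<sigma> * A" "B = - \<sigma> * B" "\<alpha> (\<theta> v) = \<sigma> * A" "\<zeta> (\<theta> v) = - \<sigma> * B"
      using AB[of w] AB[of "\<theta> w"] AB[of v] par v w unfolding has_parity_def by auto
    then have "\<alpha> (\<theta> v) = A \<and> \<zeta> (\<theta> v) = B" by simp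
    then show "\<exists>A B. \<forall>v\<in>V. \<alpha> v = A \<and> \<zeta> v = B"
      using AB unfolding V by blast
  qed
  ultimately show ?thesis by blast
qed

text \<open>Rigidity after adding the orbit of \<open>ab\<close> means that, modulo constants, there is at most one
  motion of each parity before adding it, and that motion is not constant on \<open>{a, b}\<close>.\<close>

lemma add_orbit_generator:
  assumes G: "sym_multigraph W \<theta> \<mu>" and P: "sym_placement W \<theta> x y z"
    and ab: "a \<in> W" "b \<in> W" "a \<noteq> b" and small: "\<mu> a b \<le> 1"
    and rig: "parity_rigid W \<theta> (add_orbit \<theta> a b \<mu>) x y z" and s: "\<sigma> \<in> {1, -1}"
  obtains \<alpha>\<^sub>0 \<zeta>\<^sub>0 where "\<alpha>\<^sub>0 a \<noteq> \<alpha>\<^sub>0 b \<or> \<zeta>\<^sub>0 a \<noteq> \<zeta>\<^sub>0 b"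
    "\<And>\<alpha> \<zeta>. bond_motion W \<mu> x y z \<alpha> \<zeta> \<Longrightarrow> has_parity W \<theta> \<sigma> \<alpha> \<zeta> \<Longrightarrow>
       \<exists>c A B. \<forall>w\<in>W. \<alpha> w = A + c * \<alpha>\<^sub>0 w \<and> \<zeta> w = B + c * \<zeta>\<^sub>0 w"
proof -
  have T: "\<theta> v \<in> W" "\<theta> (\<theta> v) = v" "\<theta> v \<noteq> v" if "v \<in> W" for v
    using sym_multigraphD(2-4)[OF G that] by auto
  define S where "S = y a * x b - x a * y b"
  \<comment> \<open>The functional \<phi> built from \<open>p\<close> and \<open>q\<close> is what
    the new edge adds. For a pair within one orbit, parity already makes one of the two differences
    zero, so their sum controls the other. For an existing single edge, the row perpendicular to its
    own turns it into a bond. Otherwise it is the row of the new edge itself.\<close>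
  define p q where "p = (if b = \<theta> a then 1 else if \<mu> a b = 1 then - (z a - z b) else S)"
    and "q = (if b = \<theta> a then 1 else if \<mu> a b = 1 then S else z a - z b)"
  define \<phi> where "\<phi> \<alpha> \<zeta> = p * (\<alpha> a - \<alpha> b) + q * (\<zeta> a - \<zeta> b)" for \<alpha> \<zeta> :: "'a \<Rightarrow> real"
  have const: "\<exists>A B. \<forall>w\<in>W. \<alpha> w = A \<and> \<zeta> w = B"
    if m: "bond_motion W \<mu> x y z \<alpha> \<zeta>" and par: "has_parity W \<theta> \<sigma> \<alpha> \<zeta>" and f: "\<phi> \<alpha> \<zeta> = 0" for \<alpha> \<zeta>
  proof -
    have pa: "\<alpha> (\<theta> a) = \<sigma> * \<alpha> a" "\<zeta> (\<theta> a) = - \<sigma> * \<zeta> a" "\<alpha> (\<theta> b) = \<sigma> * \<alpha> b" "\<zeta> (\<theta> b) = - \<sigma> * \<zeta> b"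
      using par ab unfolding has_parity_def by auto
    have xa: "x (\<theta> a) = - x a" "y (\<theta> a) = - y a" "z (\<theta> a) = - z a"
      "x (\<theta> b) = - x b" "y (\<theta> b) = - y b" "z (\<theta> b) = - z b"
      using sym_placementD(2-4)[OF P ab(1)] sym_placementD(2-4)[OF P ab(2)] by auto
    have new: "(if b = \<theta> a \<or> \<mu> a b = 1 then \<alpha> a = \<alpha> b \<and> \<zeta> a = \<zeta> b
       else S * (\<alpha> a - \<alpha> b) + (z a - z b) * (\<zeta> a - \<zeta> b) = 0)"
    proof (cases "b = \<theta> a")
      case True
      then have "\<alpha> a - \<alpha> b + (\<zeta> a - \<zeta> b) = 0" using f unfolding \<phi>_def p_def q_def by simp
      then show ?thesis using True pa s by auto
    next
      case ba: False
      have S: "S \<noteq> 0" unfolding S_def using sym_placementD(5)[OF P ab(1,2)] ab(3) ba by auto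
      show ?thesis
      proof (cases "\<mu> a b = 1")
        case True
        then have 1: "S * (\<alpha> a - \<alpha> b) + (z a - z b) * (\<zeta> a - \<zeta> b) = 0"
          using m ab unfolding bond_motion_def S_def by blast
        have 2: "- (z a - z b) * (\<alpha> a - \<alpha> b) + S * (\<zeta> a - \<zeta> b) = 0"
          using f True ba unfolding \<phi>_def p_def q_def by simp
        have "(S\<^sup>2 + (z a - z b)\<^sup>2) * (\<alpha> a - \<alpha> b) = 0" "(S\<^sup>2 + (z a - z b)\<^sup>2) * (\<zeta> a - \<zeta> b) = 0"
          using 1 2 by algebra+
        moreover have "S\<^sup>2 + (z a - z b)\<^sup>2 \<noteq> 0" using S by (simp add: sum_power2_eq_zero_iff)
        ultimately have "\<alpha> a = \<alpha> b \<and> \<zeta> a = \<zeta> b" by (metis eq_iff_diff_eq_0 mult_eq_0_iff)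
        then show ?thesis using True by simp
      next
        case False
        then show ?thesis using f ba unfolding \<phi>_def p_def q_def by simp
      qed
    qed
    have "bond_motion W (add_orbit \<theta> a b \<mu>) x y z \<alpha> \<zeta>"
      unfolding bond_motion_def
    proof (intro ballI)
      fix u w assume uw: "u \<in> W" "w \<in> W"
      let ?g = "(add_orbit \<theta> a b \<mu> u w = 1 \<longrightarrow> (y u * x w - x u * y w) * (\<alpha> u - \<alpha> w) + (z u - z w) * (\<zeta> u - \<zeta> w) = 0)
        \<and> (2 \<le> add_orbit \<theta> a b \<mu> u w \<longrightarrow> \<alpha> u = \<alpha> w \<and> \<zeta> u = \<zeta> w)"
      have old: ?g if "{u, w} \<noteq> {a, b}" "{u, w} \<noteq> {\<theta> a, \<theta> b}"
        using m uw that unfolding bond_motion_def by (simp add: add_orbit_def)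
      have mu: "\<mu> (\<theta> a) (\<theta> b) = \<mu> a b" "\<mu> b a = \<mu> a b" "\<mu> (\<theta> b) (\<theta> a) = \<mu> a b"
        using sym_multigraphD(7,8)[OF G] ab T by metis+
      have ao: "add_orbit \<theta> a b \<mu> u w = 1 \<Longrightarrow> b \<noteq> \<theta> a \<and> \<mu> a b \<noteq> 1"
          "2 \<le> add_orbit \<theta> a b \<mu> u w \<Longrightarrow> b = \<theta> a \<or> \<mu> a b = 1"
        if uw': "u = a \<and> w = b \<or> u = b \<and> w = a \<or> u = \<theta> a \<and> w = \<theta> b \<or> u = \<theta> b \<and> w = \<theta> a"
      proof -
        have "add_orbit \<theta> a b \<mu> u w = \<mu> a b + (if b = \<theta> a then 2 else 1)"
        proof (cases "b = \<theta> a")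
          case True
          then show ?thesis using uw' mu T(2)[OF ab(1)] unfolding add_orbit_def by auto
        next
          case False
          then have ne: "{a, b} \<noteq> {\<theta> a, \<theta> b}" using T(3)[OF ab(1)] T(2)[OF ab(1)] T(2)[OF ab(2)]
            by (auto simp: doubleton_eq_iff)
          have mu': "\<mu> u w = \<mu> a b" using uw' mu by metis
          have "{u, w} = {a, b} \<or> {u, w} = {\<theta> a, \<theta> b}" using uw' by auto
          then show ?thesis
          proof
            assume "{u, w} = {a, b}"
            then show ?thesis unfolding add_orbit_def mu' using ne False by (simp only:) simp
          next
            assume "{u, w} = {\<theta> a, \<theta> b}"
            then show ?thesis unfolding add_orbit_def mu' using ne[symmetric] False by (simp only:) simp
          qed
        qed
        then show "add_orbit \<theta> a b \<mu> u w = 1 \<Longrightarrow> b \<noteq> \<theta> a \<and> \<mu> a b \<noteq> 1"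
          "2 \<le> add_orbit \<theta> a b \<mu> u w \<Longrightarrow> b = \<theta> a \<or> \<mu> a b = 1"
          using small by (auto split: if_splits)
      qed
      have fresh: "(if b = \<theta> a \<or> \<mu> a b = 1 then \<alpha> u = \<alpha> w \<and> \<zeta> u = \<zeta> w
         else (y u * x w - x u * y w) * (\<alpha> u - \<alpha> w) + (z u - z w) * (\<zeta> u - \<zeta> w) = 0)"
        if uw': "u = a \<and> w = b \<or> u = b \<and> w = a \<or> u = \<theta> a \<and> w = \<theta> b \<or> u = \<theta> b \<and> w = \<theta> a"
      proof (cases "b = \<theta> a \<or> \<mu> a b = 1")
        case True
        then show ?thesis using uw' new pa by auto
      next
        case False
        then have e: "(y a * x b - x a * y b) * (\<alpha> a - \<alpha> b) + (z a - z b) * (\<zeta> a - \<zeta> b) = 0"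
          using new unfolding S_def by simp
        have "(y u * x w - x u * y w) * (\<alpha> u - \<alpha> w) + (z u - z w) * (\<zeta> u - \<zeta> w)
          = (if u = a \<and> w = b \<or> u = b \<and> w = a then 1 else \<sigma>) *
            ((y a * x b - x a * y b) * (\<alpha> a - \<alpha> b) + (z a - z b) * (\<zeta> a - \<zeta> b))"
          using uw' pa xa by (auto simp: algebra_simps)
        then show ?thesis using False e by simp
      qed
      show ?g
      proof (cases "u = a \<and> w = b \<or> u = b \<and> w = a \<or> u = \<theta> a \<and> w = \<theta> b \<or> u = \<theta> b \<and> w = \<theta> a")
        case True
        then show ?thesis using ao[OF True] fresh[OF True] by (auto split: if_splits)
      next
        case False
        then show ?thesis using old unfolding doubleton_eq_iff by blast
      qed
    qed
    then show ?thesis using rig s par unfolding parity_rigid_def by blast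
  qed
  show thesis
  proof (cases "\<exists>\<alpha> \<zeta>. bond_motion W \<mu> x y z \<alpha> \<zeta> \<and> has_parity W \<theta> \<sigma> \<alpha> \<zeta> \<and> \<phi> \<alpha> \<zeta> \<noteq> 0")
    case True
    then obtain \<alpha>\<^sub>0 \<zeta>\<^sub>0 where 0: "bond_motion W \<mu> x y z \<alpha>\<^sub>0 \<zeta>\<^sub>0" "has_parity W \<theta> \<sigma> \<alpha>\<^sub>0 \<zeta>\<^sub>0" "\<phi> \<alpha>\<^sub>0 \<zeta>\<^sub>0 \<noteq> 0"
      by blast
    show thesis
    proof (rule that[of \<alpha>\<^sub>0 \<zeta>\<^sub>0])
      show "\<alpha>\<^sub>0 a \<noteq> \<alpha>\<^sub>0 b \<or> \<zeta>\<^sub>0 a \<noteq> \<zeta>\<^sub>0 b" using 0(3) unfolding \<phi>_def by auto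
      fix \<alpha> \<zeta> assume m: "bond_motion W \<mu> x y z \<alpha> \<zeta>" "has_parity W \<theta> \<sigma> \<alpha> \<zeta>"
      \<comment> \<open>With this multiple of the generator subtracted, \<phi> vanishes and
        \<open>const\<close> applies.\<close>
      define c where "c = \<phi> \<alpha> \<zeta> / \<phi> \<alpha>\<^sub>0 \<zeta>\<^sub>0"
      have "\<phi> (\<lambda>v. \<alpha> v + (- c) * \<alpha>\<^sub>0 v) (\<lambda>v. \<zeta> v + (- c) * \<zeta>\<^sub>0 v) = \<phi> \<alpha> \<zeta> - c * \<phi> \<alpha>\<^sub>0 \<zeta>\<^sub>0"
        unfolding \<phi>_def by (simp add: algebra_simps)
      also have "\<dots> = 0" using 0(3) unfolding c_def by simp
      finally obtain A B where "\<forall>w\<in>W. \<alpha> w + (- c) * \<alpha>\<^sub>0 w = A \<and> \<zeta> w + (- c) * \<zeta>\<^sub>0 w = B"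
        using const[OF bond_motion_combine[OF m(1) 0(1)] has_parity_combine[OF m(2) 0(2)]] by blast
      then have "\<forall>w\<in>W. \<alpha> w = A + c * \<alpha>\<^sub>0 w \<and> \<zeta> w = B + c * \<zeta>\<^sub>0 w" by (auto simp: algebra_simps)
      then show "\<exists>c A B. \<forall>w\<in>W. \<alpha> w = A + c * \<alpha>\<^sub>0 w \<and> \<zeta> w = B + c * \<zeta>\<^sub>0 w" by blast
    qed
  next
    case False
    show thesis
    \<comment> \<open>All motions are constant in this case. The generator is then a dummy that
      separates \<open>a\<close> from \<open>b\<close>; it need not be a motion, and its coefficient
      is 0.\<close>
    proof (rule that[of "\<lambda>w. of_bool (w = a)" "\<lambda>w. 0"])
      fix \<alpha> \<zeta> assume "bond_motion W \<mu> x y z \<alpha> \<zeta>" "has_parity W \<theta> \<sigma> \<alpha> \<zeta>"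
      then obtain A B where "\<forall>w\<in>W. \<alpha> w = A \<and> \<zeta> w = B" using const False by blast
      then have "\<forall>w\<in>W. \<alpha> w = A + 0 * of_bool (w = a) \<and> \<zeta> w = B + 0 * 0" by simp
      then show "\<exists>c A B. \<forall>w\<in>W. \<alpha> w = A + c * of_bool (w = a) \<and> \<zeta> w = B + c * 0" by blast
    qed (use ab in auto)
  qed
qed

text \<open>Adjoining \<open>v\<close> to a tight set raises \<open>4 * card X\<close> by 4 and the
  degree sum by twice the multiplicity from \<open>v\<close> into it, which sparsity caps.\<close>

lemma tight_joint_degree:
  assumes G: "sym_multigraph V \<theta> \<mu>" and sp: "sparse_multigraph V \<mu>" and v: "v \<in> V"
    and X: "X \<subseteq> V - {v}" "X \<noteq> {}" and t: "degree_sum \<mu> X + 4 = 4 * card X"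
  shows "(\<Sum>w\<in>X. \<mu> v w) \<le> 2"
proof -
  have fin: "finite X" using sym_multigraphD(1)[OF G] X finite_subset by auto
  have "degree_sum \<mu> (insert v X) = degree_sum \<mu> X + 2 * (\<Sum>w\<in>X. \<mu> v w)"
    by (rule degree_sum_insert[OF fin]) (use sym_multigraphD(5,8)[OF G] v X in auto)
  moreover have "insert v X \<subseteq> V" "insert v X \<noteq> {}" using X v by auto
  then have "degree_sum \<mu> (insert v X) + 4 \<le> 4 * card (insert v X)"
    using sp unfolding sparse_multigraph_def by blast
  moreover have "card (insert v X) = card X + 1"
    using fin X by (subst card_insert_disjoint) auto
  ultimately show ?thesis using t by linarith
qed

text \<open>The velocity is already constant on \<open>W\<close>, and two unknowns remain at
  \<open>v\<close>. A bond or two bars fix them; with a bond to \<open>\<theta> v\<close>, parity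
  fixes one and a single bar the other.\<close>

lemma parity_rigid_extend_tight:
  assumes G: "sym_multigraph V \<theta> \<mu>" and v: "v \<in> V" and W: "W = V - {v, \<theta> v}" "W \<noteq> {}"
    and P: "sym_placement W \<theta> x y z" and R: "parity_rigid W \<theta> \<mu> x y z"
    and nbrs: "\<mu> v (\<theta> v) = 2 \<and> (\<exists>a\<in>W. \<mu> v a = 1) \<or> (\<exists>a\<in>W. \<mu> v a = 2) \<or>
      (\<exists>a\<in>W. \<exists>b\<in>W. a \<noteq> b \<and> \<mu> v a = 1 \<and> \<mu> v b = 1)"
  shows "\<exists>x y z. sym_placement V \<theta> x y z \<and> parity_rigid V \<theta> \<mu> x y z"
proof (rule extend_placement[OF G v W P])
  fix \<sigma> :: real assume s: "\<sigma> \<in> {1, -1}"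
  have tW: "\<theta> ` W = W" by (rule degree_sum_remove_orbit(3)[OF G v W(1)])
  let ?good = "\<lambda>k h \<alpha> \<zeta>. bond_motion W \<mu> x y z \<alpha> \<zeta> \<longrightarrow> has_parity V \<theta> \<sigma> \<alpha> \<zeta> \<longrightarrow>
      joint_motion W \<mu> v x y z k h \<alpha> \<zeta> \<longrightarrow>
      (2 \<le> \<mu> v (\<theta> v) \<longrightarrow> \<alpha> v = \<alpha> (\<theta> v) \<and> \<zeta> v = \<zeta> (\<theta> v)) \<longrightarrow>
      (\<exists>A B. \<forall>w\<in>insert v W. \<alpha> w = A \<and> \<zeta> w = B)"
  have const: "\<exists>A B. (\<forall>w\<in>W. \<alpha> w = A \<and> \<zeta> w = B) \<and> A = \<sigma> * A \<and> B = - \<sigma> * B"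
    if m: "bond_motion W \<mu> x y z \<alpha> \<zeta>" and par: "has_parity V \<theta> \<sigma> \<alpha> \<zeta>" for \<alpha> \<zeta>
  proof -
    have parW: "has_parity W \<theta> \<sigma> \<alpha> \<zeta>" using par W unfolding has_parity_def by auto
    then obtain A B where AB: "\<forall>w\<in>W. \<alpha> w = A \<and> \<zeta> w = B"
      using R m s unfolding parity_rigid_def by blast
    obtain w where w: "w \<in> W" using W by auto
    then have "\<theta> w \<in> W" using tW by auto
    then have "\<alpha> (\<theta> w) = A" "\<zeta> (\<theta> w) = B" "\<alpha> w = A" "\<zeta> w = B" using AB w by blast+
    moreover have "\<alpha> (\<theta> w) = \<sigma> * \<alpha> w" "\<zeta> (\<theta> w) = - \<sigma> * \<zeta> w"
      using parW w unfolding has_parity_def by blast+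
    ultimately have "A = \<sigma> * A \<and> B = - \<sigma> * B" by metis
    then show ?thesis using AB by blast
  qed
  from nbrs consider
      (loop) a where "\<mu> v (\<theta> v) = 2" "a \<in> W" "\<mu> v a = 1"
    | (double) a where "a \<in> W" "\<mu> v a = 2"
    | (distinct) a b where "a \<in> W" "b \<in> W" "a \<noteq> b" "\<mu> v a = 1" "\<mu> v b = 1" by blast
  then show "\<forall>\<^sub>F k in cofinite. \<forall>\<^sub>F h in cofinite. \<forall>\<alpha> \<zeta>. ?good k h \<alpha> \<zeta>"
  proof cases
    case loop
    have "\<forall>\<^sub>F k in cofinite. \<forall>\<^sub>F h in cofinite.
        bar k h (x a) (y a) (z a) 1 0 \<noteq> 0 \<and> bar k h (x a) (y a) (z a) 0 1 \<noteq> 0"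
      using one_bar[OF sym_placementD(1)[OF P loop(2)] disjI1[OF one_neq_zero], of "z a" 0]
        one_bar[OF sym_placementD(1)[OF P loop(2)] disjI2[OF one_neq_zero], of "z a" 0]
      by eventually_elim (simp add: eventually_conj_iff)
    then show ?thesis
    proof (elim eventually_mono, intro allI impI)
      fix k h \<alpha> \<zeta>
      assume nz: "bar k h (x a) (y a) (z a) 1 0 \<noteq> 0 \<and> bar k h (x a) (y a) (z a) 0 1 \<noteq> 0"
        and m: "bond_motion W \<mu> x y z \<alpha> \<zeta>" and par: "has_parity V \<theta> \<sigma> \<alpha> \<zeta>"
        and j: "joint_motion W \<mu> v x y z k h \<alpha> \<zeta>"
        and eq: "2 \<le> \<mu> v (\<theta> v) \<longrightarrow> \<alpha> v = \<alpha> (\<theta> v) \<and> \<zeta> v = \<zeta> (\<theta> v)"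
      obtain A B where AB: "\<forall>w\<in>W. \<alpha> w = A \<and> \<zeta> w = B" "A = \<sigma> * A" "B = - \<sigma> * B"
        using const[OF m par] by blast
      have b: "bar k h (x a) (y a) (z a) (\<alpha> v - A) (\<zeta> v - B) = 0"
        using j loop AB(1) unfolding joint_motion_def by simp
      have "\<alpha> (\<theta> v) = \<sigma> * \<alpha> v" "\<zeta> (\<theta> v) = - \<sigma> * \<zeta> v"
        using par v unfolding has_parity_def by blast+
      then have v\<sigma>: "\<alpha> v = \<sigma> * \<alpha> v" "\<zeta> v = - \<sigma> * \<zeta> v" using eq loop(1) by simp_all
      consider "\<sigma> = 1" | "\<sigma> = - 1" using s by blast
      \<comment> \<open>The bond inside the orbit makes both components at \<open>v\<close>
        invariant, so the odd one is zero, as is the corresponding constant on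
        \<open>W\<close>.\<close>
      then have "\<zeta> v = B \<or> \<alpha> v = A"
      proof cases
        case 1
        then have "\<zeta> v = - \<zeta> v" "B = - B" using v\<sigma>(2) AB(3) by (metis mult_minus1)+
        then show ?thesis by linarith
      next
        case 2
        then have "\<alpha> v = - \<alpha> v" "A = - A" using v\<sigma>(1) AB(2) by (metis mult_minus1)+
        then show ?thesis by linarith
      qed
      then have "\<alpha> v = A \<and> \<zeta> v = B" using b nz unfolding bar_def by auto
      then show "\<exists>A B. \<forall>w\<in>insert v W. \<alpha> w = A \<and> \<zeta> w = B" using AB by blast
    qed
  next
    case double
    show ?thesis
    proof (intro always_eventually allI impI)
      fix k h \<alpha> \<zeta>
      assume m: "bond_motion W \<mu> x y z \<alpha> \<zeta>" and par: "has_parity V \<theta> \<sigma> \<alpha> \<zeta>"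
        and j: "joint_motion W \<mu> v x y z k h \<alpha> \<zeta>"
      obtain A B where AB: "\<forall>w\<in>W. \<alpha> w = A \<and> \<zeta> w = B" using const[OF m par] by blast
      then have "\<alpha> v = A \<and> \<zeta> v = B" using j double unfolding joint_motion_def by simp
      then show "\<exists>A B. \<forall>w\<in>insert v W. \<alpha> w = A \<and> \<zeta> w = B" using AB by blast
    qed
  next
    case distinct
    show ?thesis
      using two_bars[OF sym_placement_distinct[OF P distinct(1-3)], of "z a" "z b"]
    proof (elim eventually_mono, intro allI impI)
      fix k h \<alpha> \<zeta>
      assume nz: "\<forall>\<alpha> \<zeta>. bar k h (x a) (y a) (z a) \<alpha> \<zeta> = 0 \<and> bar k h (x b) (y b) (z b) \<alpha> \<zeta> = 0 \<longrightarrow> \<alpha> = 0 \<and> \<zeta> = 0"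
        and m: "bond_motion W \<mu> x y z \<alpha> \<zeta>" and par: "has_parity V \<theta> \<sigma> \<alpha> \<zeta>"
        and j: "joint_motion W \<mu> v x y z k h \<alpha> \<zeta>"
      obtain A B where AB: "\<forall>w\<in>W. \<alpha> w = A \<and> \<zeta> w = B" using const[OF m par] by blast
      have "bar k h (x a) (y a) (z a) (\<alpha> v - A) (\<zeta> v - B) = 0"
        "bar k h (x b) (y b) (z b) (\<alpha> v - A) (\<zeta> v - B) = 0"
        using j distinct AB(1) unfolding joint_motion_def by auto
      then have "\<alpha> v - A = 0 \<and> \<zeta> v - B = 0" using nz by blast
      then have "\<alpha> v = A \<and> \<zeta> v = B" by simp
      then show "\<exists>A B. \<forall>w\<in>insert v W. \<alpha> w = A \<and> \<zeta> w = B" using AB by blast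
    qed
  qed
qed

text \<open>On \<open>W\<close> a motion is a constant plus \<open>c\<close> times one generator,
  which differs between \<open>a\<close> and \<open>b\<close>. With a bond to \<open>a\<close>, the
  bar to \<open>b\<close> measures \<open>c\<close> times that difference. With three bars,
  \<open>three_bars\<close> rules out a nonzero \<open>c\<close>, and two of the bars then fix
  \<open>v\<close>.\<close>

lemma parity_rigid_extend_orbit:
  assumes G: "sym_multigraph V \<theta> \<mu>" and v: "v \<in> V" and W: "W = V - {v, \<theta> v}"
    and P: "sym_placement W \<theta> x y z"
    and ab: "a \<in> W" "b \<in> W" "a \<noteq> b" "\<mu> a b \<le> 1" "\<mu> v b = 1"
    and R: "parity_rigid W \<theta> (add_orbit \<theta> a b \<mu>) x y z"
    and nbrs: "\<mu> v a = 2 \<or> \<mu> v a = 1 \<and> (\<exists>c\<in>W. c \<noteq> a \<and> c \<noteq> b \<and> \<mu> v c = 1)"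
  shows "\<exists>x y z. sym_placement V \<theta> x y z \<and> parity_rigid V \<theta> \<mu> x y z"
proof (rule extend_placement[OF G v W _ P])
  show "W \<noteq> {}" using ab by auto
  fix \<sigma> :: real assume s: "\<sigma> \<in> {1, -1}"
  have "\<theta> ` W = W" by (rule degree_sum_remove_orbit(3)[OF G v W])
  then have GW: "sym_multigraph W \<theta> \<mu>" using sym_multigraph_subset[OF G, of W] W by auto
  obtain \<alpha>\<^sub>0 \<zeta>\<^sub>0 where nc: "\<alpha>\<^sub>0 a \<noteq> \<alpha>\<^sub>0 b \<or> \<zeta>\<^sub>0 a \<noteq> \<zeta>\<^sub>0 b"
    and gen0: "\<And>\<alpha> \<zeta>. bond_motion W \<mu> x y z \<alpha> \<zeta> \<Longrightarrow> has_parity W \<theta> \<sigma> \<alpha> \<zeta> \<Longrightarrow>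
       \<exists>c A B. \<forall>w\<in>W. \<alpha> w = A + c * \<alpha>\<^sub>0 w \<and> \<zeta> w = B + c * \<zeta>\<^sub>0 w"
    using add_orbit_generator[OF GW P ab(1-4) R s] by blast
  have gen: "\<exists>c A B. \<forall>w\<in>W. \<alpha> w = A + c * \<alpha>\<^sub>0 w \<and> \<zeta> w = B + c * \<zeta>\<^sub>0 w"
    if "bond_motion W \<mu> x y z \<alpha> \<zeta>" "has_parity V \<theta> \<sigma> \<alpha> \<zeta>" for \<alpha> \<zeta>
    using gen0 that W unfolding has_parity_def by auto
  show "\<forall>\<^sub>F k in cofinite. \<forall>\<^sub>F h in cofinite. \<forall>\<alpha> \<zeta>. bond_motion W \<mu> x y z \<alpha> \<zeta> \<longrightarrow> has_parity V \<theta> \<sigma> \<alpha> \<zeta> \<longrightarrow>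
      joint_motion W \<mu> v x y z k h \<alpha> \<zeta> \<longrightarrow>
      (2 \<le> \<mu> v (\<theta> v) \<longrightarrow> \<alpha> v = \<alpha> (\<theta> v) \<and> \<zeta> v = \<zeta> (\<theta> v)) \<longrightarrow>
      (\<exists>A B. \<forall>w\<in>insert v W. \<alpha> w = A \<and> \<zeta> w = B)"
    using nbrs
  proof
    assume a2: "\<mu> v a = 2"
    have "\<alpha>\<^sub>0 a - \<alpha>\<^sub>0 b \<noteq> 0 \<or> \<zeta>\<^sub>0 a - \<zeta>\<^sub>0 b \<noteq> 0" using nc by auto
    from one_bar[OF sym_placementD(1)[OF P ab(2)] this, of "z b"] show ?thesis
    proof (elim eventually_mono, intro allI impI)
      fix k h \<alpha> \<zeta>
      assume nz: "bar k h (x b) (y b) (z b) (\<alpha>\<^sub>0 a - \<alpha>\<^sub>0 b) (\<zeta>\<^sub>0 a - \<zeta>\<^sub>0 b) \<noteq> 0"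
        and m: "bond_motion W \<mu> x y z \<alpha> \<zeta>" and par: "has_parity V \<theta> \<sigma> \<alpha> \<zeta>"
        and j: "joint_motion W \<mu> v x y z k h \<alpha> \<zeta>"
      obtain c A B where AB: "\<forall>w\<in>W. \<alpha> w = A + c * \<alpha>\<^sub>0 w \<and> \<zeta> w = B + c * \<zeta>\<^sub>0 w"
        using gen[OF m par] by blast
      have va: "\<alpha> v = \<alpha> a" "\<zeta> v = \<zeta> a" using j a2 ab(1) unfolding joint_motion_def by auto
      have "bar k h (x b) (y b) (z b) (\<alpha> a - \<alpha> b) (\<zeta> a - \<zeta> b) = 0"
        using j ab va unfolding joint_motion_def by auto
      moreover have "bar k h (x b) (y b) (z b) (\<alpha> a - \<alpha> b) (\<zeta> a - \<zeta> b)
          = c * bar k h (x b) (y b) (z b) (\<alpha>\<^sub>0 a - \<alpha>\<^sub>0 b) (\<zeta>\<^sub>0 a - \<zeta>\<^sub>0 b)"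
        using AB ab unfolding bar_def by (simp add: algebra_simps)
      ultimately have "c = 0" using nz by simp
      then have "\<forall>w\<in>insert v W. \<alpha> w = A \<and> \<zeta> w = B" using AB va ab by simp
      then show "\<exists>A B. \<forall>w\<in>insert v W. \<alpha> w = A \<and> \<zeta> w = B" by blast
    qed
  next
    assume "\<mu> v a = 1 \<and> (\<exists>c\<in>W. c \<noteq> a \<and> c \<noteq> b \<and> \<mu> v c = 1)"
    then obtain e where a1: "\<mu> v a = 1" and e: "e \<in> W" "a \<noteq> e" "b \<noteq> e" "\<mu> v e = 1" by blast
    have "\<not> (\<alpha>\<^sub>0 a = \<alpha>\<^sub>0 b \<and> \<alpha>\<^sub>0 b = \<alpha>\<^sub>0 e \<and> \<zeta>\<^sub>0 a = \<zeta>\<^sub>0 b \<and> \<zeta>\<^sub>0 b = \<zeta>\<^sub>0 e)" using nc by auto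
    from three_bars_placement[OF GW P ab(1,2) e(1) ab(3) e(2,3) this]
      two_bars[OF sym_placement_distinct[OF P ab(1-3)], of "z a" "z b"]
    have "\<forall>\<^sub>F k in cofinite. \<forall>\<^sub>F h in cofinite.
       (\<forall>A B. \<not> (\<forall>w\<in>{a, b, e}. bar k h (x w) (y w) (z w) (A - \<alpha>\<^sub>0 w) (B - \<zeta>\<^sub>0 w) = 0)) \<and>
       (\<forall>\<alpha> \<zeta>. bar k h (x a) (y a) (z a) \<alpha> \<zeta> = 0 \<and> bar k h (x b) (y b) (z b) \<alpha> \<zeta> = 0 \<longrightarrow> \<alpha> = 0 \<and> \<zeta> = 0)"
      by eventually_elim (rule eventually_conj)
    then show ?thesis
    proof (elim eventually_mono, intro allI impI)
      fix k h \<alpha> \<zeta>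
      assume nz: "(\<forall>A B. \<not> (\<forall>w\<in>{a, b, e}. bar k h (x w) (y w) (z w) (A - \<alpha>\<^sub>0 w) (B - \<zeta>\<^sub>0 w) = 0)) \<and>
       (\<forall>\<alpha> \<zeta>. bar k h (x a) (y a) (z a) \<alpha> \<zeta> = 0 \<and> bar k h (x b) (y b) (z b) \<alpha> \<zeta> = 0 \<longrightarrow> \<alpha> = 0 \<and> \<zeta> = 0)"
        and m: "bond_motion W \<mu> x y z \<alpha> \<zeta>" and par: "has_parity V \<theta> \<sigma> \<alpha> \<zeta>"
        and j: "joint_motion W \<mu> v x y z k h \<alpha> \<zeta>"
      obtain c A B where AB: "\<forall>w\<in>W. \<alpha> w = A + c * \<alpha>\<^sub>0 w \<and> \<zeta> w = B + c * \<zeta>\<^sub>0 w"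
        using gen[OF m par] by blast
      have bars: "bar k h (x w) (y w) (z w) (\<alpha> v - \<alpha> w) (\<zeta> v - \<zeta> w) = 0" if "w \<in> {a, b, e}" for w
        using that j ab e a1 unfolding joint_motion_def by auto
      have "c = 0"
      proof (rule ccontr)
        assume c: "c \<noteq> 0"
        \<comment> \<open>Subtracting the constants and dividing by \<open>c\<close> turns the
          motion on \<open>W\<close> into the generator, which was fixed before \<open>k\<close> and
          \<open>h\<close> were chosen.\<close>
        have "bar k h (x w) (y w) (z w) ((\<alpha> v - A) / c - \<alpha>\<^sub>0 w) ((\<zeta> v - B) / c - \<zeta>\<^sub>0 w) = 0"
          if w: "w \<in> {a, b, e}" for w
        proof -
          have "w \<in> W" using w ab e by auto
          then have "\<alpha> v - \<alpha> w = c * ((\<alpha> v - A) / c - \<alpha>\<^sub>0 w)" "\<zeta> v - \<zeta> w = c * ((\<zeta> v - B) / c - \<zeta>\<^sub>0 w)"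
            using AB c by (auto simp: field_simps)
          then have "c * bar k h (x w) (y w) (z w) ((\<alpha> v - A) / c - \<alpha>\<^sub>0 w) ((\<zeta> v - B) / c - \<zeta>\<^sub>0 w) = 0"
            using bars[OF w] unfolding bar_def by (simp only:) (simp add: algebra_simps)
          then show ?thesis using c by simp
        qed
        then show False using nz by blast
      qed
      then have const: "\<forall>w\<in>W. \<alpha> w = A \<and> \<zeta> w = B" using AB by simp
      then have "bar k h (x a) (y a) (z a) (\<alpha> v - A) (\<zeta> v - B) = 0"
        "bar k h (x b) (y b) (z b) (\<alpha> v - A) (\<zeta> v - B) = 0"
        using bars[of a] bars[of b] ab(1,2) by simp_all
      then have "\<alpha> v - A = 0 \<and> \<zeta> v - B = 0" using nz by blast
      then have "\<forall>w\<in>insert v W. \<alpha> w = A \<and> \<zeta> w = B" using const by simp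
      then show "\<exists>A B. \<forall>w\<in>insert v W. \<alpha> w = A \<and> \<zeta> w = B" by blast
    qed
  qed
qed

section \<open>Induction on the number of vertices\<close>

theorem tight_parity_rigid:
  assumes "sym_multigraph V \<theta> \<mu>" "tight_multigraph V \<mu>"
  shows "\<exists>x y z. sym_placement V \<theta> x y z \<and> parity_rigid V \<theta> \<mu> x y z"
  using assms
proof (induction "card V" arbitrary: V \<mu> rule: less_induct)
  case less
  note G = less.prems(1)
  note D = sym_multigraphD[OF G]
  have sp: "sparse_multigraph V \<mu>" and ti: "degree_sum \<mu> V + 4 = 4 * card V"
    using less.prems(2) unfolding tight_multigraph_def by auto
  \<comment> \<open>The degrees add up to \<open>4 * card V - 4\<close>, so their average is below
    4.\<close>
  have "\<exists>v\<in>V. (\<Sum>w\<in>V. \<mu> v w) \<le> 3"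
  proof (rule ccontr)
    assume "\<not> ?thesis"
    then have "(\<Sum>v\<in>V. 4) \<le> (\<Sum>v\<in>V. \<Sum>w\<in>V. \<mu> v w)" by (intro sum_mono) force
    also have "\<dots> = degree_sum \<mu> V" by (simp add: degree_sum_def sum.cartesian_product)
    finally show False using ti by simp
  qed
  then obtain v where v: "v \<in> V" and deg: "(\<Sum>w\<in>V. \<mu> v w) \<le> 3" by blast
  define W where "W = V - {v, \<theta> v}"
  note R = degree_sum_remove_orbit[OF G v W_def]
  have V: "V = insert v (insert (\<theta> v) W)" using v D(2)[OF v] unfolding W_def by auto
  have finW: "finite W" using D(1) unfolding W_def by simp
  have nW: "v \<notin> W" "\<theta> v \<notin> W" and WV: "W \<subseteq> V" unfolding W_def by auto
  have GW: "sym_multigraph W \<theta> \<mu>" using sym_multigraph_subset[OF G WV] R(3) by simp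
  have spW: "sparse_multigraph W \<mu>"
    using sp WV unfolding sparse_multigraph_def by (meson order_trans)
  have "(\<Sum>w\<in>V. \<mu> v w) = \<mu> v v + (\<mu> v (\<theta> v) + (\<Sum>w\<in>W. \<mu> v w))"
    unfolding V using finW nW D(4)[OF v] by simp
  then have deg': "\<mu> v (\<theta> v) + (\<Sum>w\<in>W. \<mu> v w) \<le> 3" using deg D(5)[OF v] by simp
  have le2: "\<mu> u w \<le> 2" if "u \<in> V" "w \<in> V" "u \<noteq> w" for u w
  proof -
    have "{u, w} \<subseteq> V" "{u, w} \<noteq> {}" using that by auto
    then have "degree_sum \<mu> {u, w} + 4 \<le> 4 * card {u, w}"
      using sp unfolding sparse_multigraph_def by blast
    then show ?thesis
      unfolding degree_sum_pair[where \<mu> = \<mu>, OF that(3) D(8)[OF that(1,2)] D(5)[OF that(1)] D(5)[OF that(2)]]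
      using that(3) by simp
  qed
  show ?case
  proof (cases "W = {}")
    case True
    \<comment> \<open>A tight multigraph on a single orbit is a bond, which is rigid in any
      antipodal placement.\<close>
    then have "2 * \<mu> v (\<theta> v) + 4 = 4 * 2" using R(1,2) ti by (simp add: degree_sum_def)
    then have m2: "\<mu> v (\<theta> v) = 2" by simp
    have V2: "V = {v, \<theta> v}" using V True by simp
    define x y z where "x = (\<lambda>w. if w = v then 1 else - 1 :: real)" and "y = (\<lambda>w :: 'a. 0 :: real)"
      and "z = (\<lambda>w :: 'a. 0 :: real)"
    have "sym_placement V \<theta> x y z"
      using D(3)[OF v] D(4)[OF v] unfolding sym_placement_def V2 x_def y_def z_def by auto
    moreover have "parity_rigid V \<theta> \<mu> x y z"
      unfolding parity_rigid_def
    proof (intro ballI allI impI)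
      fix \<sigma> :: real and \<alpha> \<zeta> assume "bond_motion V \<mu> x y z \<alpha> \<zeta> \<and> has_parity V \<theta> \<sigma> \<alpha> \<zeta>"
      then have "\<alpha> v = \<alpha> (\<theta> v) \<and> \<zeta> v = \<zeta> (\<theta> v)"
        using m2 v D(2)[OF v] unfolding bond_motion_def by auto
      then show "\<exists>A B. \<forall>v\<in>V. \<alpha> v = A \<and> \<zeta> v = B" unfolding V2 by auto
    qed
    ultimately show ?thesis by blast
  next
    case W0: False
    have "degree_sum \<mu> W + 4 \<le> 4 * card W"
      using spW W0 unfolding sparse_multigraph_def by blast
    \<comment> \<open>Two vertices fewer lower \<open>4 * card V\<close> by 8, so sparsity of
      \<open>W\<close> forces the degree sum to drop by at least 8. With the degree bound and
      evenness only three cases remain.\<close>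
    then have ge: "2 * (\<Sum>w\<in>W. \<mu> v w) + \<mu> v (\<theta> v) \<ge> 4" using R(1,2) ti by linarith
    have ev: "even (\<mu> v (\<theta> v))" by (rule D(6)[OF v])
    have "\<mu> v (\<theta> v) = 2 \<and> (\<Sum>w\<in>W. \<mu> v w) = 1 \<or> \<mu> v (\<theta> v) = 0 \<and> (\<Sum>w\<in>W. \<mu> v w) = 2 \<or>
        \<mu> v (\<theta> v) = 0 \<and> (\<Sum>w\<in>W. \<mu> v w) = 3"
    proof -
      have "m = 2 \<and> n = 1 \<or> m = 0 \<and> n = 2 \<or> m = 0 \<and> n = 3"
        if "m + n \<le> 3" "2 * n + m \<ge> 4" "even m" for m n :: nat
        using that by presburger
      from this[OF deg' ge ev] show ?thesis .
    qed
    then consider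
        (tight) "4 * (\<Sum>w\<in>W. \<mu> v w) + 2 * \<mu> v (\<theta> v) = 8"
          "\<mu> v (\<theta> v) = 2 \<and> (\<Sum>w\<in>W. \<mu> v w) = 1 \<or> (\<Sum>w\<in>W. \<mu> v w) = 2"
      | (three) "\<mu> v (\<theta> v) = 0" "(\<Sum>w\<in>W. \<mu> v w) = 3" by auto
    then show ?thesis
    proof cases
      case tight
      then have "degree_sum \<mu> W + 4 = 4 * card W" using R(1,2) ti by linarith
      then have tW: "tight_multigraph W \<mu>" using spW unfolding tight_multigraph_def by simp
      obtain x y z where xyz: "sym_placement W \<theta> x y z" "parity_rigid W \<theta> \<mu> x y z"
        using less.hyps[OF _ GW tW] R(2) by auto
      show ?thesis
      proof (rule parity_rigid_extend_tight[OF G v W_def W0 xyz])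
        show "\<mu> v (\<theta> v) = 2 \<and> (\<exists>a\<in>W. \<mu> v a = 1) \<or> (\<exists>a\<in>W. \<mu> v a = 2) \<or>
          (\<exists>a\<in>W. \<exists>b\<in>W. a \<noteq> b \<and> \<mu> v a = 1 \<and> \<mu> v b = 1)"
          using tight(2)
        proof
          assume "\<mu> v (\<theta> v) = 2 \<and> (\<Sum>w\<in>W. \<mu> v w) = 1"
          moreover from this have "\<exists>a\<in>W. \<mu> v a = 1" using sum_eq_1_iff[OF finW, of "\<mu> v"] by blast
          ultimately show ?thesis by blast
        next
          assume "(\<Sum>w\<in>W. \<mu> v w) = 2"
          with finW show ?thesis by (cases rule: sum_eq_2_cases) blast+
        qed
      qed
    next
      case three
      \<comment> \<open>The rest falls short of tightness by 4, which is exactly what an added orbit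
        contributes.\<close>
      then have dW: "degree_sum \<mu> W + 8 = 4 * card W" using R(1,2) ti by linarith
      have no_tight: "degree_sum \<mu> X + 4 \<noteq> 4 * card X" if X: "X \<subseteq> W" "X \<noteq> {}" "(\<Sum>w\<in>X. \<mu> v w) \<ge> 3" for X
      proof
        assume "degree_sum \<mu> X + 4 = 4 * card X"
        moreover have "X \<subseteq> V - {v}" using X W_def by auto
        ultimately show False using tight_joint_degree[OF G sp v _ X(2)] X(3) by fastforce
      qed
      have step: ?thesis
        if ab: "a \<in> W" "b \<in> W" "a \<noteq> b" "\<mu> v b = 1"
          and nt: "\<And>X. X \<subseteq> W \<Longrightarrow> a \<in> X \<Longrightarrow> b \<in> X \<Longrightarrow> degree_sum \<mu> X + 4 \<noteq> 4 * card X"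
          and nbrs: "\<mu> v a = 2 \<or> \<mu> v a = 1 \<and> (\<exists>c\<in>W. c \<noteq> a \<and> c \<noteq> b \<and> \<mu> v c = 1)" for a b
      proof -
        have inV: "a \<in> V" "b \<in> V" using ab WV by auto
        have "degree_sum \<mu> {a, b} = 2 * \<mu> a b"
          by (rule degree_sum_pair[where \<mu> = \<mu>, OF ab(3) D(8)[OF inV] D(5)[OF inV(1)] D(5)[OF inV(2)]])
        \<comment> \<open>A bond between \<open>a\<close> and \<open>b\<close> would make
          \<open>{a, b}\<close> a tight set.\<close>
        then have "\<mu> a b \<noteq> 2" using nt[of "{a, b}"] ab by auto
        then have small: "\<mu> a b \<le> 1" using le2[OF inV ab(3)] by simp
        let ?\<nu> = "add_orbit \<theta> a b \<mu>"
        have "\<theta> a \<in> W" "\<theta> b \<in> W" "\<theta> a \<noteq> \<theta> b"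
          using R(3) ab D(3) inV by (auto, metis)
        then have "degree_sum ?\<nu> W + 4 = 4 * card W"
          using degree_sum_add_orbit[OF finW ab(3), of \<theta> \<mu>] ab dW by simp
        then have "tight_multigraph W ?\<nu>"
          using sparse_add_orbit[OF GW spW ab(1-3) nt] unfolding tight_multigraph_def by blast
        then obtain x y z where xyz: "sym_placement W \<theta> x y z" "parity_rigid W \<theta> ?\<nu> x y z"
          using less.hyps[OF _ sym_multigraph_add_orbit[OF GW ab(1-3)]] R(2) by auto
        show ?thesis
          by (rule parity_rigid_extend_orbit[OF G v W_def xyz(1) ab(1-3) small ab(4) xyz(2) nbrs])
      qed
      have "\<forall>w\<in>W. \<mu> v w \<le> 2" using le2[OF v] WV nW by auto
      with finW three(2) show ?thesis
      proof (cases rule: sum_eq_3_cases)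
        case (double a b)
        show ?thesis
        proof (rule step[of a b])
          fix X assume X: "X \<subseteq> W" "a \<in> X" "b \<in> X"
          then have "(\<Sum>w\<in>{a, b}. \<mu> v w) \<le> (\<Sum>w\<in>X. \<mu> v w)"
            using finite_subset[OF _ finW] by (intro sum_mono2) auto
          then show "degree_sum \<mu> X + 4 \<noteq> 4 * card X" using no_tight[of X] X double by auto
        qed (use double in auto)
      next
        case (distinct a b c)
        have abc: "degree_sum \<mu> X + 4 \<noteq> 4 * card X" if X: "X \<subseteq> W" "a \<in> X" "b \<in> X" "c \<in> X" for X
        proof -
          have "(\<Sum>w\<in>{a, b, c}. \<mu> v w) \<le> (\<Sum>w\<in>X. \<mu> v w)"
            using X finite_subset[OF _ finW] by (intro sum_mono2) auto
          then show ?thesis using no_tight[of X] X distinct by auto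
        qed
        show ?thesis
        proof (cases "\<exists>X\<subseteq>W. a \<in> X \<and> b \<in> X \<and> degree_sum \<mu> X + 4 = 4 * card X")
          case False
          show ?thesis
          proof (rule step[of a b])
            fix X assume "X \<subseteq> W" "a \<in> X" "b \<in> X"
            then show "degree_sum \<mu> X + 4 \<noteq> 4 * card X" using False by blast
          next
            have "c \<noteq> a" "c \<noteq> b" using distinct by auto
            then show "\<mu> v a = 2 \<or> \<mu> v a = 1 \<and> (\<exists>c\<in>W. c \<noteq> a \<and> c \<noteq> b \<and> \<mu> v c = 1)"
              using distinct by blast
          qed (fact distinct)+
        next
          case True
          then obtain X where X: "X \<subseteq> W" "a \<in> X" "b \<in> X" "degree_sum \<mu> X + 4 = 4 * card X" by blast
          \<comment> \<open>A tight \<open>Y\<close> would meet \<open>X\<close> in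
            \<open>b\<close>, and the union would be a tight set containing all three neighbours. So
            if the pair \<open>a\<close>, \<open>b\<close> fails, the pair \<open>b\<close>,
            \<open>c\<close> works.\<close>
          have "degree_sum \<mu> Y + 4 \<noteq> 4 * card Y" if Y: "Y \<subseteq> W" "b \<in> Y" "c \<in> Y" for Y
          proof
            assume "degree_sum \<mu> Y + 4 = 4 * card Y"
            then have "degree_sum \<mu> (X \<union> Y) + 4 = 4 * card (X \<union> Y)"
              using tight_union[OF spW finW X(1) Y(1) _ X(4)] X Y by blast
            then show False using abc[of "X \<union> Y"] X Y by simp
          qed
          moreover have "\<mu> v b = 2 \<or> \<mu> v b = 1 \<and> (\<exists>e\<in>W. e \<noteq> b \<and> e \<noteq> c \<and> \<mu> v e = 1)"
            using distinct by blast
          ultimately show ?thesis by (rule step[OF distinct(2,3,6,9)])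
        qed
      qed
    qed
  qed
qed

section \<open>Counting equations and unknowns\<close>

definition linear_functional :: "(('j \<Rightarrow> real) \<Rightarrow> real) \<Rightarrow> bool" where
  "linear_functional f \<longleftrightarrow> (\<forall>a b x y. f (\<lambda>j. a * x j + b * y j) = a * f x + b * f y)"

lemma linear_functionalD:
  "linear_functional f \<Longrightarrow> f (\<lambda>j. a * x j + b * y j) = a * f x + b * f y"
  unfolding linear_functional_def by blast

lemma linear_functional_expand:
  assumes f: "linear_functional f" and "finite J"
  shows "f (\<lambda>j. if j \<in> J then x j else 0) = (\<Sum>j\<in>J. f (\<lambda>i. of_bool (i = j)) * x j)"
  using assms(2)
proof (induction J rule: finite_induct)
  case empty
  then show ?case using linear_functionalD[OF f, of 0 "\<lambda>j. 0" 0 "\<lambda>j. 0"] by simp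
next
  case (insert k J)
  have "(\<lambda>j. if j \<in> insert k J then x j else 0)
      = (\<lambda>j. x k * of_bool (j = k) + 1 * (if j \<in> J then x j else 0))"
    using insert.hyps by auto
  then have "f (\<lambda>j. if j \<in> insert k J then x j else 0)
      = x k * f (\<lambda>j. of_bool (j = k)) + 1 * f (\<lambda>j. if j \<in> J then x j else 0)"
    using linear_functionalD[OF f] by metis
  then show ?case using insert by simp
qed

text \<open>Gaussian elimination: a pivot \<open>k\<close> of equation \<open>i\<close> eliminates
  one unknown together with that equation, and its value is recovered from equation \<open>i\<close>
  at the end.\<close>

lemma homogeneous_system:
  fixes A :: "'i \<Rightarrow> 'j \<Rightarrow> real"
  assumes "finite I" "finite J" "card I < card J"
  shows "\<exists>x. (\<exists>j\<in>J. x j \<noteq> 0) \<and> (\<forall>i\<in>I. (\<Sum>j\<in>J. A i j * x j) = 0)"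
  using assms
proof (induction I arbitrary: J A rule: finite_induct)
  case empty
  then have "J \<noteq> {}" by auto
  then show ?case by (intro exI[of _ "\<lambda>_. 1"]) auto
next
  case (insert i I)
  show ?case
  proof (cases "\<forall>j\<in>J. A i j = 0")
    case True
    then show ?thesis using insert.IH[of J A] insert.prems insert.hyps by auto
  next
    case False
    then obtain k where k: "k \<in> J" "A i k \<noteq> 0" by blast
    let ?J = "J - {k}"
    have "card I < card ?J" using insert.prems insert.hyps k(1) by simp
    then obtain x where x: "\<exists>j\<in>?J. x j \<noteq> 0"
        "\<forall>l\<in>I. (\<Sum>j\<in>?J. (A l j - A l k * A i j / A i k) * x j) = 0"
      using insert.IH[of ?J "\<lambda>l j. A l j - A l k * A i j / A i k"] insert.prems(1) by blast
    define y where "y = x(k := - (\<Sum>j\<in>?J. A i j * x j) / A i k)"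
    have S: "(\<Sum>j\<in>J. A l j * y j) = A l k * y k + (\<Sum>j\<in>?J. A l j * x j)" for l
    proof -
      have "(\<Sum>j\<in>J. A l j * y j) = A l k * y k + (\<Sum>j\<in>?J. A l j * y j)"
        using insert.prems(1) k(1) by (rule sum.remove)
      also have "(\<Sum>j\<in>?J. A l j * y j) = (\<Sum>j\<in>?J. A l j * x j)"
        by (rule sum.cong) (auto simp: y_def)
      finally show ?thesis .
    qed
    have "(\<Sum>j\<in>J. A l j * y j) = 0" if "l \<in> insert i I" for l
    proof (cases "l = i")
      case True
      then show ?thesis unfolding S using k(2) by (simp add: y_def)
    next
      case False
      then have "(\<Sum>j\<in>?J. (A l j - A l k * A i j / A i k) * x j) = 0" using x(2) that by auto
      moreover have "(\<Sum>j\<in>?J. (A l j - A l k * A i j / A i k) * x j)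
          = (\<Sum>j\<in>?J. A l j * x j) - A l k / A i k * (\<Sum>j\<in>?J. A i j * x j)"
        by (simp add: left_diff_distrib sum_subtractf sum_distrib_left mult.assoc)
      ultimately show ?thesis unfolding S by (simp add: y_def)
    qed
    moreover have "\<exists>j\<in>J. y j \<noteq> 0" using x(1) by (auto simp: y_def)
    ultimately show ?thesis by blast
  qed
qed

lemma linear_functionals_common_zero:
  assumes F: "finite F" "\<And>f. f \<in> F \<Longrightarrow> linear_functional f" and J: "finite J" "card F < card J"
  shows "\<exists>x. (\<exists>j\<in>J. x j \<noteq> 0) \<and> (\<forall>j. j \<notin> J \<longrightarrow> x j = 0) \<and> (\<forall>f\<in>F. f x = 0)"
proof -
  obtain x where x: "\<exists>j\<in>J. x j \<noteq> 0" "\<forall>f\<in>F. (\<Sum>j\<in>J. f (\<lambda>i. of_bool (i = j)) * x j) = 0"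
    using homogeneous_system[OF F(1) J, of "\<lambda>f j. f (\<lambda>i. of_bool (i = j))"] by blast
  let ?y = "\<lambda>j. if j \<in> J then x j else 0"
  have "f ?y = 0" if "f \<in> F" for f
    using linear_functional_expand[OF F(2)[OF that] J(1), of x] x(2) that by simp
  then show ?thesis using x(1) by (intro exI[of _ ?y]) auto
qed

text \<open>This picks one element from each two-element orbit. It serves both vertices and unfixed
  edges when equations are counted up to symmetry.\<close>

lemma free_involution_transversal:
  assumes "finite N" "\<And>e. e \<in> N \<Longrightarrow> g e \<in> N \<and> g (g e) = e \<and> g e \<noteq> e"
  shows "\<exists>B\<subseteq>N. N = B \<union> g ` B \<and> 2 * card B = card N"
  using assms
proof (induction "card N" arbitrary: N rule: less_induct)
  case less
  show ?case
  proof (cases "N = {}")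
    case True
    then show ?thesis by auto
  next
    case False
    then obtain e where e: "e \<in> N" by auto
    let ?M = "N - {e, g e}"
    have ge: "g e \<in> N" "g (g e) = e" "g e \<noteq> e" using less.prems(2)[OF e] by auto
    have cN: "card N = card ?M + 2"
    proof -
      have "N = insert e (insert (g e) ?M)" using e ge by auto
      then have "card N = card (insert e (insert (g e) ?M))" by simp
      then show ?thesis using less.prems(1) ge by simp
    qed
    have M: "g f \<in> ?M \<and> g (g f) = f \<and> g f \<noteq> f" if "f \<in> ?M" for f
    proof -
      have f: "g f \<in> N" "g (g f) = f" "g f \<noteq> f" using less.prems(2)[of f] that by auto
      have "g f \<noteq> e" "g f \<noteq> g e" using f ge that by (metis Diff_iff insert_iff)+
      then show ?thesis using f by simp
    qed
    have "card ?M < card N" "finite ?M" using cN less.prems(1) by auto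
    from less.hyps[OF this M] obtain B
      where B: "B \<subseteq> ?M" "?M = B \<union> g ` B" "2 * card B = card ?M" by blast
    have "finite B" using B(1) less.prems(1) finite_subset by auto
    moreover have "e \<notin> B" using B(1) by auto
    ultimately have "2 * card (insert e B) = card N" using B(3) cN by simp
    moreover have "N = insert e B \<union> g ` insert e B" using B(2) e ge by auto
    moreover have "insert e B \<subseteq> N" using B(1) e by auto
    ultimately show ?thesis by blast
  qed
qed

section \<open>Frameworks on the cylinder\<close>

lemma simple_graph_edgeE:
  assumes "simple_graph V E" "e \<in> E"
  obtains u w where "e = {u, w}" "u \<noteq> w" "u \<in> V" "w \<in> V"
  using assms unfolding simple_graph_def by blast

lemma simple_graph_edge_subset: "simple_graph V E \<Longrightarrow> e \<in> E \<Longrightarrow> e \<subseteq> V"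
  by (elim simple_graph_edgeE) auto

lemma simple_graph_finite:
  assumes "simple_graph V E"
  shows "finite V" "finite E"
proof -
  show fin: "finite V" using assms by (simp add: simple_graph_def)
  have "E \<subseteq> Pow V" using simple_graph_edge_subset[OF assms] by auto
  then show "finite E" by (rule finite_subset) (use fin in simp)
qed

text \<open>The choice operator may return either orientation of the edge, and exchanging the ends
  changes both factors of the inner product by a sign.\<close>

lemma edge_row_pair:
  assumes "u \<noteq> w"
  shows "edge_row p {u, w} q = inner (p u - p w) (q u - q w)"
proof -
  obtain a b where ab: "(SOME (a, b). {u, w} = {a, b} \<and> a \<noteq> b) = (a, b)" by fastforce
  have "case (SOME (a, b). {u, w} = {a, b} \<and> a \<noteq> b) of (a, b) \<Rightarrow> {u, w} = {a, b} \<and> a \<noteq> b"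
    by (rule someI[where x = "(u, w)"]) (use assms in auto)
  then have "{u, w} = {a, b}" unfolding ab by simp
  then have "a = u \<and> b = w \<or> a = w \<and> b = u" by (auto simp: doubleton_eq_iff)
  then show ?thesis unfolding edge_row_def ab Let_def
    by (auto simp: inner_diff_left inner_diff_right)
qed

lemma edge_row_linear:
  "edge_row p e (\<lambda>v. a *\<^sub>R q v + b *\<^sub>R q' v) = a * edge_row p e q + b * edge_row p e q'"
  unfolding edge_row_def Let_def case_prod_unfold by (simp add: inner_add_right algebra_simps)

definition tangent :: "('a \<Rightarrow> real^3) \<Rightarrow> ('a \<Rightarrow> real) \<Rightarrow> ('a \<Rightarrow> real) \<Rightarrow> 'a \<Rightarrow> real^3" where
  "tangent p \<alpha> \<zeta> v = vector [- (p v $ 2) * \<alpha> v, p v $ 1 * \<alpha> v, \<zeta> v]"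

lemma edge_row_tangent:
  assumes "u \<noteq> w"
  shows "edge_row p {u, w} (tangent p \<alpha> \<zeta>) =
    (p u $ 2 * p w $ 1 - p u $ 1 * p w $ 2) * (\<alpha> u - \<alpha> w) + (p u $ 3 - p w $ 3) * (\<zeta> u - \<zeta> w)"
  unfolding edge_row_pair[OF assms] tangent_def
  by (simp add: inner_vec_def sum_3 vector_3 algebra_simps)

lemma edge_row_tangent_linear:
  "edge_row p e (tangent p (\<lambda>v. a * \<alpha> v + b * \<alpha>' v) (\<lambda>v. a * \<zeta> v + b * \<zeta>' v))
    = a * edge_row p e (tangent p \<alpha> \<zeta>) + b * edge_row p e (tangent p \<alpha>' \<zeta>')"
proof -
  have "tangent p (\<lambda>v. a * \<alpha> v + b * \<alpha>' v) (\<lambda>v. a * \<zeta> v + b * \<zeta>' v)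
      = (\<lambda>v. a *\<^sub>R tangent p \<alpha> \<zeta> v + b *\<^sub>R tangent p \<alpha>' \<zeta>' v)"
    by (rule ext) (simp add: vec_eq_iff forall_3 tangent_def vector_3 algebra_simps)
  then show ?thesis by (simp add: edge_row_linear)
qed

lemma vertex_row_tangent: "vertex_row p v (tangent p \<alpha> \<zeta>) = 0"
  by (simp add: vertex_row_def tangent_def inner_vec_def sum_3 vector_3)

text \<open>This is the expansion of \<open>q v\<close> in the orthonormal frame of tangential,
  axial and normal directions; \<open>vertex_row\<close> is the normal component.\<close>

lemma cylinder_frame:
  assumes "on_cylinder (p v)"
  shows "q v = (p v $ 1 * q v $ 2 - p v $ 2 * q v $ 1) *\<^sub>R vector [- (p v $ 2), p v $ 1, 0]
    + (q v $ 3) *\<^sub>R vector [0, 0, 1] + vertex_row p v q *\<^sub>R vector [p v $ 1, p v $ 2, 0]"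
proof -
  let ?x = "p v $ 1" and ?y = "p v $ 2" and ?a = "q v $ 1" and ?b = "q v $ 2"
  have c: "?x\<^sup>2 + ?y\<^sup>2 = 1" using assms by (simp add: on_cylinder_def)
  have r: "vertex_row p v q = ?x * ?a + ?y * ?b"
    by (simp add: vertex_row_def inner_vec_def sum_3 vector_3)
  have "(?x * ?b - ?y * ?a) * - ?y + (?x * ?a + ?y * ?b) * ?x = (?x\<^sup>2 + ?y\<^sup>2) * ?a"
    "(?x * ?b - ?y * ?a) * ?x + (?x * ?a + ?y * ?b) * ?y = (?x\<^sup>2 + ?y\<^sup>2) * ?b"
    by (simp_all add: algebra_simps power2_eq_square)
  then show ?thesis unfolding r c by (simp add: vec_eq_iff forall_3 vector_3)
qed

definition inf_rigid :: "'a set \<Rightarrow> 'a set set \<Rightarrow> ('a \<Rightarrow> real^3) \<Rightarrow> bool" where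
  "inf_rigid V E p \<longleftrightarrow> (\<forall>\<alpha> \<zeta>. (\<forall>e\<in>E. edge_row p e (tangent p \<alpha> \<zeta>) = 0) \<longrightarrow>
     (\<exists>A B. \<forall>v\<in>V. \<alpha> v = A \<and> \<zeta> v = B))"

text \<open>The vertex rows leave exactly the tangential fields. Rotation about the axis and
  translation along it are the constant \<alpha> and the constant \<zeta>.\<close>

lemma inf_rigid_iff_kernel:
  assumes g: "simple_graph V E" and c: "\<forall>v\<in>V. on_cylinder (p v)"
  shows "inf_rigid V E p \<longleftrightarrow> (\<forall>q. in_kernel V E p q \<longrightarrow>
    (\<exists>a b. \<forall>v\<in>V. q v = (vector [0, 0, a] :: real^3) + b *\<^sub>R (vector [- (p v $ 2), p v $ 1, 0] :: real^3)))"
    (is "_ \<longleftrightarrow> ?R")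
proof
  assume rig: "inf_rigid V E p"
  show ?R
  proof (intro allI impI)
    fix q assume q: "in_kernel V E p q"
    define \<alpha> \<zeta> where "\<alpha> = (\<lambda>v. p v $ 1 * q v $ 2 - p v $ 2 * q v $ 1)" and "\<zeta> = (\<lambda>v. q v $ 3)"
    have qv: "q v = tangent p \<alpha> \<zeta> v" if "v \<in> V" for v
    proof -
      have "vertex_row p v q = 0" using q that unfolding in_kernel_def by blast
      then have "q v = \<alpha> v *\<^sub>R vector [- (p v $ 2), p v $ 1, 0] + (\<zeta> v) *\<^sub>R vector [0, 0, 1]"
        using cylinder_frame[of p v q] c that unfolding \<alpha>_def \<zeta>_def by simp
      then show ?thesis by (simp add: tangent_def vec_eq_iff forall_3 vector_3)
    qed
    have "edge_row p e (tangent p \<alpha> \<zeta>) = 0" if e: "e \<in> E" for e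
    proof -
      obtain u w where uw: "e = {u, w}" "u \<noteq> w" "u \<in> V" "w \<in> V" using simple_graph_edgeE[OF g e] .
      have "edge_row p e (tangent p \<alpha> \<zeta>) = edge_row p e q"
        unfolding uw(1) edge_row_pair[OF uw(2)] using qv uw by simp
      then show ?thesis using q e unfolding in_kernel_def by simp
    qed
    then obtain A B where "\<forall>v\<in>V. \<alpha> v = A \<and> \<zeta> v = B" using rig unfolding inf_rigid_def by blast
    then have "\<forall>v\<in>V. q v = vector [0, 0, B] + A *\<^sub>R vector [- (p v $ 2), p v $ 1, 0]"
      using qv by (simp add: tangent_def vec_eq_iff forall_3 vector_3)
    then show "\<exists>a b. \<forall>v\<in>V. q v = vector [0, 0, a] + b *\<^sub>R vector [- (p v $ 2), p v $ 1, 0]" by blast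
  qed
next
  assume R: ?R
  show "inf_rigid V E p"
    unfolding inf_rigid_def
  proof (intro allI impI)
    fix \<alpha> \<zeta> assume "\<forall>e\<in>E. edge_row p e (tangent p \<alpha> \<zeta>) = 0"
    then have "in_kernel V E p (tangent p \<alpha> \<zeta>)"
      unfolding in_kernel_def by (simp add: vertex_row_tangent)
    then obtain a b where ab: "\<forall>v\<in>V. tangent p \<alpha> \<zeta> v = vector [0, 0, a] + b *\<^sub>R vector [- (p v $ 2), p v $ 1, 0]"
      using R by blast
    have "\<alpha> v = b \<and> \<zeta> v = a" if v: "v \<in> V" for v
    proof -
      have "p v $ 2 * \<alpha> v = p v $ 2 * b" "p v $ 1 * \<alpha> v = p v $ 1 * b" "\<zeta> v = a"
        using ab v by (auto simp: tangent_def vec_eq_iff forall_3 vector_3 algebra_simps)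
      moreover have "p v $ 2 \<noteq> 0 \<or> p v $ 1 \<noteq> 0" using c v by (auto simp: on_cylinder_def)
      ultimately show ?thesis by auto
    qed
    then show "\<exists>A B. \<forall>v\<in>V. \<alpha> v = A \<and> \<zeta> v = B" by blast
  qed
qed

text \<open>The unknowns \<open>x (v, True)\<close> and \<open>x (v, False)\<close> are the angular and the vertical velocity of \<open>v\<close>.\<close>

lemma inf_rigid_count:
  assumes rig: "inf_rigid V E p" and fin: "finite V"
    and F: "finite F" "\<And>f. f \<in> F \<Longrightarrow> linear_functional f"
    and rows: "\<And>x e. \<forall>f\<in>F. f x = 0 \<Longrightarrow> e \<in> E \<Longrightarrow>
      edge_row p e (tangent p (\<lambda>v. x (v, True)) (\<lambda>v. x (v, False))) = 0"
    and pin: "\<And>x A B. \<forall>f\<in>F. f x = 0 \<Longrightarrow> \<forall>v\<in>V. x (v, True) = A \<and> x (v, False) = B \<Longrightarrow> A = 0 \<and> B = 0"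
  shows "2 * card V \<le> card F"
proof (rule ccontr)
  assume "\<not> ?thesis"
  then have "card F < card (V \<times> (UNIV :: bool set))" by (simp add: card_cartesian_product)
  then obtain x :: "'a \<times> bool \<Rightarrow> real" where x: "\<exists>j\<in>V \<times> UNIV. x j \<noteq> 0" "\<forall>f\<in>F. f x = 0"
    using linear_functionals_common_zero[OF F, of "V \<times> UNIV"] fin by auto
  obtain A B where AB: "\<forall>v\<in>V. x (v, True) = A \<and> x (v, False) = B"
    using rig rows[OF x(2)] unfolding inf_rigid_def by blast
  have "A = 0 \<and> B = 0" by (rule pin[OF x(2) AB])
  then have "x (v, b) = 0" if "v \<in> V" for v b using AB that by (cases b) auto
  then show False using x(1) by auto
qed

abbreviation motion_row :: "('a \<Rightarrow> real^3) \<Rightarrow> 'a set \<Rightarrow> ('a \<times> bool \<Rightarrow> real) \<Rightarrow> real" where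
  "motion_row p e x \<equiv> edge_row p e (tangent p (\<lambda>v. x (v, True)) (\<lambda>v. x (v, False)))"

lemma linear_motion_row: "linear_functional (motion_row p e)"
  unfolding linear_functional_def by (simp add: edge_row_tangent_linear)

text \<open>Two further equations, fixing both velocity components of one vertex, kill the constant
  motions. The system then has only the zero solution on \<open>V\<close> and needs as many
  equations as unknowns.\<close>

lemma inf_rigid_count_rows:
  assumes rig: "inf_rigid V E p" and fin: "finite V" "finite E'" and "V \<noteq> {}"
    and rows: "\<And>x e. \<forall>e\<in>E'. motion_row p e x = 0 \<Longrightarrow> e \<in> E \<Longrightarrow> motion_row p e x = 0"
  shows "2 * card V \<le> card E' + 2"
proof -
  obtain v where v: "v \<in> V" using assms by auto
  let ?F = "motion_row p ` E' \<union> {\<lambda>x. x (v, True), \<lambda>x. x (v, False)}"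
  have "2 * card V \<le> card ?F"
  proof (rule inf_rigid_count[OF rig fin(1)])
    fix f assume "f \<in> ?F"
    then show "linear_functional f" by (auto simp: linear_motion_row linear_functional_def[of "\<lambda>x. x _"])
  next
    fix x e assume "\<forall>f\<in>?F. f x = 0" "e \<in> E"
    then show "motion_row p e x = 0" using rows[of x e] by auto
  next
    fix x A B assume "\<forall>f\<in>?F. f x = 0" "\<forall>v\<in>V. x (v, True) = A \<and> x (v, False) = B"
    then show "A = 0 \<and> B = 0" using v by auto
  qed (use fin in auto)
  also have "\<dots> \<le> card (motion_row p ` E') + card {\<lambda>x. x (v, True), \<lambda>x :: 'a \<times> bool \<Rightarrow> real. x (v, False)}"
    by (rule card_Un_le)
  also have "\<dots> \<le> card E' + 2"
    using card_image_le[OF fin(2), of "motion_row p"]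
      card_insert_le_m1[of 2 "{\<lambda>x :: 'a \<times> bool \<Rightarrow> real. x (v, False)}" "\<lambda>x. x (v, True)"] by simp
  finally show ?thesis .
qed

text \<open>In a dependency an edge row with nonzero coefficient would follow, on tangential fields,
  from the other edge rows. These would then be too few for rigidity.\<close>

lemma inf_rigid_rows_independent:
  assumes g: "simple_graph V E" and "V \<noteq> {}" and c: "\<forall>v\<in>V. on_cylinder (p v)"
    and rig: "inf_rigid V E p" and card: "card E + 2 = 2 * card V"
  shows "rows_independent V E p"
  unfolding rows_independent_def
proof (intro allI impI)
  note fin = simple_graph_finite[OF g]
  fix \<omega> d
  assume dep: "\<forall>q. (\<Sum>e\<in>E. \<omega> e * edge_row p e q) + (\<Sum>v\<in>V. d v * vertex_row p v q) = 0"
  have \<omega>: "\<omega> e\<^sub>0 = 0" if e\<^sub>0: "e\<^sub>0 \<in> E" for e\<^sub>0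
  proof (rule ccontr)
    assume nz: "\<omega> e\<^sub>0 \<noteq> 0"
    have "2 * card V \<le> card (E - {e\<^sub>0}) + 2"
    proof (rule inf_rigid_count_rows[OF rig fin(1) _ assms(2)])
      fix x e assume z: "\<forall>e\<in>E - {e\<^sub>0}. motion_row p e x = 0" and "e \<in> E"
      have "(\<Sum>e\<in>E. \<omega> e * motion_row p e x) = 0"
        using dep[rule_format, of "tangent p (\<lambda>v. x (v, True)) (\<lambda>v. x (v, False))"]
        by (simp add: vertex_row_tangent)
      moreover have "(\<Sum>e\<in>E. \<omega> e * motion_row p e x)
          = \<omega> e\<^sub>0 * motion_row p e\<^sub>0 x + (\<Sum>e\<in>E - {e\<^sub>0}. \<omega> e * motion_row p e x)"
        using fin(2) e\<^sub>0 by (rule sum.remove)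
      moreover have "(\<Sum>e\<in>E - {e\<^sub>0}. \<omega> e * motion_row p e x) = 0"
        by (rule sum.neutral) (use z in auto)
      ultimately have "motion_row p e\<^sub>0 x = 0" using nz by simp
      then show "motion_row p e x = 0" using z \<open>e \<in> E\<close> by (cases "e = e\<^sub>0") auto
    qed (use fin in auto)
    moreover have "card (E - {e\<^sub>0}) + 1 = card E"
      using fin(2) e\<^sub>0 by (metis Suc_eq_plus1 card_Suc_Diff1)
    ultimately show False using card by simp
  qed
  moreover have "d v = 0" if v: "v \<in> V" for v
  proof -
    \<comment> \<open>A unit normal velocity at \<open>v\<close> alone. Since all edge coefficients
      are already zero, only the vertex row of \<open>v\<close> detects it.\<close>
    define q where "q = (\<lambda>u. if u = v then vector [p v $ 1, p v $ 2, 0] else 0 :: real^3)"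
    have vr: "vertex_row p u q = of_bool (u = v)" for u
      using c v by (auto simp: vertex_row_def q_def inner_vec_def sum_3 vector_3 on_cylinder_def power2_eq_square)
    have "(\<Sum>u\<in>V. d u * vertex_row p u q) = (\<Sum>u\<in>V. if u = v then d u else 0)"
      by (rule sum.cong) (simp_all add: vr)
    then have "(\<Sum>u\<in>V. d u * vertex_row p u q) = d v" using fin(1) v by simp
    then show ?thesis using dep[rule_format, of q] \<omega> by simp
  qed
  ultimately show "(\<forall>e\<in>E. \<omega> e = 0) \<and> (\<forall>v\<in>V. d v = 0)" by blast
qed

text \<open>Motions with odd \<alpha> and even \<zeta> are counted. There are \<open>card V\<close>
  symmetry equations, one row per orbit of unfixed edges, and one pin. If some edge is fixed, there
  are fewer than \<open>card E\<close> unfixed ones, and the total stays below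
  \<open>2 * card V\<close>.\<close>

lemma inf_rigid_no_fixed_edge:
  assumes g: "simple_graph V E" and "V \<noteq> {}"
    and aut: "graph_automorphism V E \<theta>" and inv: "involution_on V \<theta>"
    and nofix: "\<not> fixes_some_vertex V \<theta>"
    and sym: "\<forall>v\<in>V. p (\<theta> v) = - p v"
    and rig: "inf_rigid V E p" and card: "card E + 2 \<le> 2 * card V"
  shows "\<not> fixes_some_edge E \<theta>"
proof
  assume "fixes_some_edge E \<theta>"
  then obtain e\<^sub>0 where e\<^sub>0: "e\<^sub>0 \<in> E" "\<theta> ` e\<^sub>0 = e\<^sub>0" unfolding fixes_some_edge_def by auto
  note fin = simple_graph_finite[OF g]
  have T: "\<theta> v \<in> V" "\<theta> (\<theta> v) = v" "\<theta> v \<noteq> v" if "v \<in> V" for v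
    using aut inv nofix that
    unfolding graph_automorphism_def involution_on_def fixes_some_vertex_def bij_betw_def by auto
  obtain A where A: "A \<subseteq> V" "V = A \<union> \<theta> ` A" "2 * card A = card V"
    using free_involution_transversal[of V \<theta>] fin T by blast
  define N where "N = {e \<in> E. \<theta> ` e \<noteq> e}"
  have "\<theta> ` e \<in> N \<and> \<theta> ` \<theta> ` e = e \<and> \<theta> ` e \<noteq> e" if e: "e \<in> N" for e
  proof -
    have eE: "e \<in> E" and ne: "\<theta> ` e \<noteq> e" using e unfolding N_def by auto
    obtain u w where uw: "e = {u, w}" "u \<noteq> w" "u \<in> V" "w \<in> V" using simple_graph_edgeE[OF g eE] .
    have "\<theta> ` e \<in> E" using aut uw eE unfolding graph_automorphism_def by auto
    moreover have "\<theta> ` \<theta> ` e = e" using T(2) uw by auto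
    ultimately show ?thesis using ne unfolding N_def by auto
  qed
  moreover have finN: "finite N" using fin unfolding N_def by simp
  ultimately obtain B where B: "B \<subseteq> N" "N = B \<union> image \<theta> ` B" "2 * card B = card N"
    using free_involution_transversal[of N "image \<theta>"] by blast
  have finAB: "finite A" "finite B" using A B fin finN finite_subset by blast+
  have "N \<subset> E" using e\<^sub>0 unfolding N_def by auto
  then have "card N < card E" using fin(2) psubset_card_mono by blast
  obtain v\<^sub>0 where v\<^sub>0: "v\<^sub>0 \<in> V" using assms by auto
  \<comment> \<open>Only the vertical component is pinned: a constant \<alpha> that is odd vanishes
    by itself.\<close>
  let ?F = "(\<lambda>v (x :: 'a \<times> bool \<Rightarrow> real). x (\<theta> v, True) + x (v, True)) ` A \<union>
    (\<lambda>v x. x (\<theta> v, False) - x (v, False)) ` A \<union> (motion_row p ` B \<union> {\<lambda>x. x (v\<^sub>0, False)})"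
  have par: "x (\<theta> v, True) = - x (v, True) \<and> x (\<theta> v, False) = x (v, False)"
    if F: "\<forall>f\<in>?F. f x = 0" and v: "v \<in> V" for x v
  proof -
    have A': "x (\<theta> a, True) = - x (a, True) \<and> x (\<theta> a, False) = x (a, False)" if "a \<in> A" for a
    proof -
      have "x (\<theta> a, True) + x (a, True) = 0" "x (\<theta> a, False) - x (a, False) = 0"
        using F that by (auto simp: ball_Un)
      then show ?thesis by auto
    qed
    show ?thesis
    proof (cases "v \<in> A")
      case False
      then obtain a where a: "a \<in> A" "v = \<theta> a" using v A(2) by auto
      then have "\<theta> v = a" using T(2) A(1) by auto
      then show ?thesis using A'[OF a(1)] a(2) by simp
    qed (rule A')
  qed
  have "2 * card V \<le> card ?F"
  proof (rule inf_rigid_count[OF rig fin(1)])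
    fix f assume "f \<in> ?F"
    then show "linear_functional f"
      by (auto simp: linear_motion_row) (auto simp: linear_functional_def algebra_simps)
  next
    fix x e assume F: "\<forall>f\<in>?F. f x = 0" and e: "e \<in> E"
    have B0: "motion_row p b x = 0" if "b \<in> B" for b using F that by (auto simp: ball_Un)
    show "motion_row p e x = 0"
    proof (cases "e \<in> N")
      case True
      show ?thesis
      proof (cases "e \<in> B")
        case False
        then obtain b where b: "b \<in> B" "e = \<theta> ` b" using True B(2) by auto
        then have "b \<in> E" using B(1) unfolding N_def by auto
        then obtain u w where uw: "b = {u, w}" "u \<noteq> w" "u \<in> V" "w \<in> V" by (rule simple_graph_edgeE[OF g])
        have "\<theta> u \<noteq> \<theta> w" using uw T(2) by metis
        then have "motion_row p e x = - motion_row p b x"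
          unfolding b(2) uw(1) using par[OF F] sym uw
          by (simp add: edge_row_tangent algebra_simps)
        then show ?thesis using B0[OF b(1)] by simp
      qed (rule B0)
    next
      case False
      obtain u w where uw: "e = {u, w}" "u \<noteq> w" "u \<in> V" "w \<in> V" using simple_graph_edgeE[OF g e] .
      have "{\<theta> u, \<theta> w} = {u, w}" using False e uw unfolding N_def by simp
      \<comment> \<open>A fixed edge joins antipodal points, so its sine coefficient is zero, and
        \<zeta> agrees at its ends. Its row vanishes without using any equation.\<close>
      then have "w = \<theta> u" using T(3)[OF uw(3)] by (auto simp: doubleton_eq_iff)
      then show ?thesis unfolding uw(1) using par[OF F uw(3)] sym uw
        by (simp add: edge_row_tangent)
    qed
  next
    fix x a b assume F: "\<forall>f\<in>?F. f x = 0" and ab: "\<forall>v\<in>V. x (v, True) = a \<and> x (v, False) = b"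
    then have "b = 0" using v\<^sub>0 by (auto simp: ball_Un)
    moreover have "a = - a" using par[OF F v\<^sub>0] ab v\<^sub>0 T(1)[OF v\<^sub>0] by simp
    ultimately show "a = 0 \<and> b = 0" by simp
  qed (use finAB in auto)
  also have "card ?F \<le> (card A + card A) + (card B + 1)"
    by (intro order_trans[OF card_Un_le] add_mono card_image_le finAB) simp
  finally show False using A(3) B(3) \<open>card N < card E\<close> card by linarith
qed

text \<open>With too many edges on \<open>V'\<close>, some nonzero combination of their rows
  vanishes on all tangential velocities at the vertices other than one. The trivial motions extend
  this to the remaining vertex, and vertex rows cancel the normal parts, which gives a
  dependency.\<close>

lemma rows_independent_sparse:
  assumes g: "simple_graph V E" and c: "\<forall>v\<in>V. on_cylinder (p v)" and ind: "rows_independent V E p"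
    and V': "V' \<subseteq> V" "V' \<noteq> {}" and E': "E' \<subseteq> E" "\<forall>e\<in>E'. e \<subseteq> V'"
  shows "card E' + 2 \<le> 2 * card V'"
proof (rule ccontr)
  assume many: "\<not> ?thesis"
  note fin = simple_graph_finite[OF g]
  have fin': "finite V'" "finite E'" using finite_subset[OF V'(1) fin(1)] finite_subset[OF E'(1) fin(2)] .
  obtain v\<^sub>0 where v\<^sub>0: "v\<^sub>0 \<in> V'" using V' by auto
  \<comment> \<open>The field with velocity \<open>r\<close> at \<open>v\<close> and zero elsewhere;
    applying \<open>R \<omega>\<close> to it reads off the combined row at \<open>v\<close> in the
    direction \<open>r\<close>.\<close>
  define \<delta> where "\<delta> v r = (\<lambda>u. if u = v then r else 0 :: real^3)" for v :: 'a and r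
  define t where "t v = (vector [- (p v $ 2), p v $ 1, 0] :: real^3)" for v
  define z where "z = (vector [0, 0, 1] :: real^3)"
  define R where "R \<omega> q = (\<Sum>e\<in>E'. \<omega> e * edge_row p e q)" for \<omega> q
  let ?F = "(\<lambda>v \<omega>. R \<omega> (\<delta> v (t v))) ` (V' - {v\<^sub>0}) \<union> (\<lambda>v \<omega>. R \<omega> (\<delta> v z)) ` (V' - {v\<^sub>0})"
  have "card ?F \<le> card (V' - {v\<^sub>0}) + card (V' - {v\<^sub>0})"
    by (intro order_trans[OF card_Un_le] add_mono card_image_le) (use fin' in auto)
  also have "\<dots> < card E'"
    using many fin'(1) v\<^sub>0 card_Suc_Diff1[OF fin'(1) v\<^sub>0] by linarith
  finally have cF: "card ?F < card E'" .
  have linF: "linear_functional f" if "f \<in> ?F" for f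
    using that by (auto simp: linear_functional_def R_def sum.distrib sum_distrib_left algebra_simps)
  have finF: "finite ?F" using fin' by auto
  obtain \<omega> where \<omega>: "\<exists>e\<in>E'. \<omega> e \<noteq> 0" "\<forall>e. e \<notin> E' \<longrightarrow> \<omega> e = 0" "\<forall>f\<in>?F. f \<omega> = 0"
    using linear_functionals_common_zero[OF finF linF fin'(2) cF] by blast
  have lin: "R \<omega> (\<lambda>v. a *\<^sub>R q v + b *\<^sub>R q' v) = a * R \<omega> q + b * R \<omega> q'" for a b q q'
    unfolding R_def edge_row_linear by (simp add: sum.distrib sum_distrib_left algebra_simps)
  have pair: "\<exists>u w. e = {u, w} \<and> u \<noteq> w \<and> u \<in> V' \<and> w \<in> V'" if e: "e \<in> E'" for e
  proof -
    have "e \<in> E" using e E' by auto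
    then obtain u w where uw: "e = {u, w}" "u \<noteq> w" using simple_graph_edgeE[OF g] by metis
    have "e \<subseteq> V'" using E'(2) e by blast
    then have "u \<in> V'" "w \<in> V'" using uw(1) by auto
    then show ?thesis using uw by blast
  qed
  have local: "R \<omega> q = R \<omega> q'" if q: "\<And>v. v \<in> V' \<Longrightarrow> q v = q' v" for q q'
  proof -
    have "edge_row p e q = edge_row p e q'" if "e \<in> E'" for e
      using pair[OF that] q by (auto simp: edge_row_pair)
    then show ?thesis unfolding R_def by simp
  qed
  have zero: "R \<omega> (\<lambda>v. 0) = 0"
    using lin[of 0 "\<lambda>v. 0" 0 "\<lambda>v. 0"] by simp
  have expand: "R \<omega> q = (\<Sum>v\<in>V'. R \<omega> (\<delta> v (q v)))" for q
  proof -
    have "R \<omega> (\<lambda>u. if u \<in> S then q u else 0) = (\<Sum>v\<in>S. R \<omega> (\<delta> v (q v)))" if "finite S" for S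
      using that
    proof (induction S rule: finite_induct)
      case empty
      then show ?case using zero by simp
    next
      case (insert v S)
      have "(\<lambda>u. if u \<in> insert v S then q u else 0)
          = (\<lambda>u. 1 *\<^sub>R \<delta> v (q v) u + 1 *\<^sub>R (if u \<in> S then q u else 0))"
        using insert.hyps by (auto simp: \<delta>_def)
      then show ?case using lin[of 1 "\<delta> v (q v)" 1 "\<lambda>u. if u \<in> S then q u else 0"] insert by simp
    qed
    from this[OF fin'(1)] local[of q "\<lambda>u. if u \<in> V' then q u else 0"] show ?thesis by simp
  qed
  have rest: "R \<omega> (\<delta> v (t v)) = 0 \<and> R \<omega> (\<delta> v z) = 0" if "v \<in> V'" "v \<noteq> v\<^sub>0" for v
    using \<omega>(3) that by (auto simp: ball_Un)
  text \<open>Rotation and translation are motions, so the two columns left out at \<open>v\<^sub>0\<close> vanish as well.\<close>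
  have rot: "R \<omega> t = 0" and trans: "R \<omega> (\<lambda>v. z) = 0"
  proof -
    have "t = tangent p (\<lambda>v. 1) (\<lambda>v. 0)" "(\<lambda>v. z) = tangent p (\<lambda>v. 0) (\<lambda>v. 1)"
      by (auto simp: t_def z_def tangent_def)
    moreover have "edge_row p e (tangent p (\<lambda>v. a) (\<lambda>v. b)) = 0" if "e \<in> E'" for e a b
      using pair[OF that] by (auto simp: edge_row_tangent)
    ultimately show "R \<omega> t = 0" "R \<omega> (\<lambda>v. z) = 0" unfolding R_def by simp_all
  qed
  have all: "R \<omega> (\<delta> v (t v)) = 0 \<and> R \<omega> (\<delta> v z) = 0" if v: "v \<in> V'" for v
  proof (cases "v = v\<^sub>0")
    case True
    have "(\<Sum>v\<in>V' - {v\<^sub>0}. R \<omega> (\<delta> v (t v))) = 0" "(\<Sum>v\<in>V' - {v\<^sub>0}. R \<omega> (\<delta> v z)) = 0"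
      using rest by (auto intro!: sum.neutral)
    then show ?thesis
      using expand[of t] expand[of "\<lambda>v. z"] rot trans True
        sum.remove[OF fin'(1) v\<^sub>0, of "\<lambda>v. R \<omega> (\<delta> v (t v))"]
        sum.remove[OF fin'(1) v\<^sub>0, of "\<lambda>v. R \<omega> (\<delta> v z)"] by simp
  qed (use rest v in blast)
  \<comment> \<open>Only normal components are left, and each is a multiple of a vertex row.\<close>
  define d where "d v = (if v \<in> V' then - R \<omega> (\<delta> v (vector [p v $ 1, p v $ 2, 0])) else 0)" for v
  have "(\<Sum>e\<in>E. \<omega> e * edge_row p e q) + (\<Sum>v\<in>V. d v * vertex_row p v q) = 0" for q
  proof -
    have "(\<Sum>e\<in>E. \<omega> e * edge_row p e q) = R \<omega> q"
      unfolding R_def by (rule sum.mono_neutral_right) (use fin E' \<omega>(2) in auto)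
    moreover have "(\<Sum>v\<in>V. d v * vertex_row p v q) = (\<Sum>v\<in>V'. d v * vertex_row p v q)"
      by (rule sum.mono_neutral_right) (use fin V' in \<open>auto simp: d_def\<close>)
    moreover have "R \<omega> (\<delta> v (q v)) = - (d v * vertex_row p v q)" if v: "v \<in> V'" for v
    proof -
      let ?a = "p v $ 1 * q v $ 2 - p v $ 2 * q v $ 1" and ?n = "vector [p v $ 1, p v $ 2, 0] :: real^3"
      have "on_cylinder (p v)" using c v V' by auto
      then have "q v = ?a *\<^sub>R t v + (q v $ 3) *\<^sub>R z + vertex_row p v q *\<^sub>R ?n"
        unfolding t_def z_def by (rule cylinder_frame)
      then have "\<delta> v (q v) = (\<lambda>u. 1 *\<^sub>R (?a *\<^sub>R \<delta> v (t v) u + (q v $ 3) *\<^sub>R \<delta> v z u)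
          + vertex_row p v q *\<^sub>R \<delta> v ?n u)"
        by (auto simp: \<delta>_def)
      then have "R \<omega> (\<delta> v (q v)) = 1 * (?a * R \<omega> (\<delta> v (t v)) + q v $ 3 * R \<omega> (\<delta> v z))
          + vertex_row p v q * R \<omega> (\<delta> v ?n)"
        by (simp only: lin)
      then show ?thesis using all[OF v] v by (simp add: d_def)
    qed
    then have "R \<omega> q = - (\<Sum>v\<in>V'. d v * vertex_row p v q)"
      by (simp add: expand[of q] sum_negf)
    ultimately show ?thesis by simp
  qed
  then have "\<forall>e\<in>E. \<omega> e = 0" using ind unfolding rows_independent_def by blast
  then show False using \<omega>(1) E' by auto
qed

section \<open>Sufficiency for simple graphs\<close>

lemma degree_sum_simple_graph:
  assumes g: "simple_graph V E" and X: "X \<subseteq> V"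
  shows "degree_sum (\<lambda>u w. of_bool ({u, w} \<in> E)) X = 2 * card {e \<in> E. e \<subseteq> X}"
proof -
  let ?E = "{e \<in> E. e \<subseteq> X}"
  note fin = simple_graph_finite[OF g]
  have finX: "finite X" using X fin finite_subset by auto
  have "degree_sum (\<lambda>u w. of_bool ({u, w} \<in> E)) X
      = (\<Sum>c\<in>X \<times> X. \<Sum>e\<in>?E. of_bool ({fst c, snd c} = e))"
    unfolding degree_sum_def case_prod_unfold
    by (rule sum.cong) (use fin in \<open>auto simp: of_bool_def\<close>)
  \<comment> \<open>After the exchange of sums, each edge is met by its two orderings.\<close>
  also have "\<dots> = (\<Sum>e\<in>?E. \<Sum>(u, w)\<in>X \<times> X. of_bool ({u, w} = e))"
    unfolding case_prod_unfold by (rule sum.swap)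
  also have "\<dots> = (\<Sum>e\<in>?E. 2)"
  proof (rule sum.cong)
    fix e assume e: "e \<in> ?E"
    then have eE: "e \<in> E" by simp
    obtain u w where uw: "e = {u, w}" "u \<noteq> w" "u \<in> V" "w \<in> V" using simple_graph_edgeE[OF g eE] .
    have "u \<in> X \<and> w \<in> X" using e uw(1) by simp
    then show "(\<Sum>(u, w)\<in>X \<times> X. of_bool ({u, w} = e)) = (2 :: nat)"
      unfolding uw(1) sum_of_bool_pair[OF finX uw(2)] by simp
  qed simp
  finally show ?thesis by simp
qed

text \<open>Inversion carries motions to motions, so adding to a motion its image, or subtracting
  it, gives motions of the two parities. Both are constant, and the original motion is half their
  sum.\<close>

lemma parity_rigid_inf_rigid:
  assumes g: "simple_graph V E"
    and aut: "graph_automorphism V E \<theta>" and inv: "involution_on V \<theta>"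
    and P: "sym_placement V \<theta> x y z" and R: "parity_rigid V \<theta> (\<lambda>u w. of_bool ({u, w} \<in> E)) x y z"
  shows "inf_rigid V E (\<lambda>v. vector [x v, y v, z v])"
  unfolding inf_rigid_def
proof (intro allI impI)
  let ?p = "\<lambda>v. vector [x v, y v, z v] :: real^3" and ?\<mu> = "\<lambda>u w. of_bool ({u, w} \<in> E) :: nat"
  fix \<alpha> \<zeta> assume m: "\<forall>e\<in>E. edge_row ?p e (tangent ?p \<alpha> \<zeta>) = 0"
  have T: "\<theta> v \<in> V" "\<theta> (\<theta> v) = v" if "v \<in> V" for v
    using aut inv that unfolding graph_automorphism_def involution_on_def bij_betw_def by auto
  have m1: "(y u * x w - x u * y w) * (\<alpha> u - \<alpha> w) + (z u - z w) * (\<zeta> u - \<zeta> w) = 0"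
    if e: "{u, w} \<in> E" for u w
  proof -
    have "u \<noteq> w" using simple_graph_edgeE[OF g e] by (auto simp: doubleton_eq_iff)
    then show ?thesis using m e edge_row_tangent[of u w ?p \<alpha> \<zeta>] by (auto simp: vector_3)
  qed
  have motion: "bond_motion V ?\<mu> x y z (\<lambda>v. \<alpha> v + \<sigma> * \<alpha> (\<theta> v)) (\<lambda>v. \<zeta> v - \<sigma> * \<zeta> (\<theta> v))" for \<sigma>
    unfolding bond_motion_def
  proof (intro ballI conjI impI)
    fix u w assume uw: "u \<in> V" "w \<in> V"
    { assume "?\<mu> u w = 1"
      then have e: "{u, w} \<in> E" by (auto simp: of_bool_def split: if_splits)
      then have e': "{\<theta> u, \<theta> w} \<in> E" using aut uw unfolding graph_automorphism_def by auto
      have "(y u * x w - x u * y w) * (\<alpha> (\<theta> u) - \<alpha> (\<theta> w)) - (z u - z w) * (\<zeta> (\<theta> u) - \<zeta> (\<theta> w)) = 0"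
        using m1[OF e'] sym_placementD(2-4)[OF P uw(1)] sym_placementD(2-4)[OF P uw(2)]
        by (simp add: algebra_simps)
      then show "(y u * x w - x u * y w) * (\<alpha> u + \<sigma> * \<alpha> (\<theta> u) - (\<alpha> w + \<sigma> * \<alpha> (\<theta> w)))
        + (z u - z w) * (\<zeta> u - \<sigma> * \<zeta> (\<theta> u) - (\<zeta> w - \<sigma> * \<zeta> (\<theta> w))) = 0"
        using m1[OF e] by algebra }
    assume "2 \<le> ?\<mu> u w"
    then have False by (auto simp: of_bool_def split: if_splits)
    then show "\<alpha> u + \<sigma> * \<alpha> (\<theta> u) = \<alpha> w + \<sigma> * \<alpha> (\<theta> w)" "\<zeta> u - \<sigma> * \<zeta> (\<theta> u) = \<zeta> w - \<sigma> * \<zeta> (\<theta> w)" by auto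
  qed
  have par: "has_parity V \<theta> \<sigma> (\<lambda>v. \<alpha> v + \<sigma> * \<alpha> (\<theta> v)) (\<lambda>v. \<zeta> v - \<sigma> * \<zeta> (\<theta> v))" if "\<sigma> \<in> {1, -1}" for \<sigma>
    using that T unfolding has_parity_def by auto
  obtain A B where 1: "\<forall>v\<in>V. \<alpha> v + 1 * \<alpha> (\<theta> v) = A \<and> \<zeta> v - 1 * \<zeta> (\<theta> v) = B"
    using R motion[of 1] par[of 1] unfolding parity_rigid_def by blast
  obtain A' B' where 2: "\<forall>v\<in>V. \<alpha> v + (- 1) * \<alpha> (\<theta> v) = A' \<and> \<zeta> v - (- 1) * \<zeta> (\<theta> v) = B'"
    using R motion[of "- 1"] par[of "- 1"] unfolding parity_rigid_def by blast
  have "\<alpha> v = (A + A') / 2 \<and> \<zeta> v = (B + B') / 2" if "v \<in> V" for v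
    using 1 2 that by fastforce
  then show "\<exists>A B. \<forall>v\<in>V. \<alpha> v = A \<and> \<zeta> v = B" by blast
qed

text \<open>Without fixed edges the multiplicity inside every orbit is 0, hence even, and the
  induction on multigraphs yields a rigid placement. The edge count then makes the rows
  independent.\<close>

lemma tight_Ci_isostatic:
  assumes g: "simple_graph V E" and V: "V \<noteq> {}"
    and aut: "graph_automorphism V E \<theta>" and inv: "involution_on V \<theta>"
    and tight: "tight22 V E" and nov: "\<not> fixes_some_vertex V \<theta>" and noe: "\<not> fixes_some_edge E \<theta>"
  shows "Ci_isostatic V E \<theta>"
proof -
  let ?\<mu> = "\<lambda>u w. of_bool ({u, w} \<in> E) :: nat"
  note fin = simple_graph_finite[OF g]
  have T: "\<theta> v \<in> V" "\<theta> (\<theta> v) = v" "\<theta> v \<noteq> v" if "v \<in> V" for v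
    using aut inv nov that
    unfolding graph_automorphism_def involution_on_def fixes_some_vertex_def bij_betw_def by auto
  have loopless: "{u, w} \<in> E \<Longrightarrow> u \<noteq> w \<and> u \<in> V \<and> w \<in> V" for u w
    using g unfolding simple_graph_def by (auto simp: doubleton_eq_iff)
  have nofix: "{u, \<theta> u} \<notin> E" if "u \<in> V" for u
  proof
    have "{\<theta> u, \<theta> (\<theta> u)} = {u, \<theta> u}" using T(2)[OF that] by auto
    moreover assume "{u, \<theta> u} \<in> E"
    ultimately show False using noe unfolding fixes_some_edge_def by blast
  qed
  have G: "sym_multigraph V \<theta> ?\<mu>"
    unfolding sym_multigraph_def
  proof (intro conjI ballI)
    fix u assume u: "u \<in> V"
    show "?\<mu> u u = 0" using loopless[of u u] by auto
    show "even (?\<mu> u (\<theta> u))" using nofix[OF u] by simp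
    fix w assume w: "w \<in> V"
    show "?\<mu> u w = ?\<mu> w u" by (simp add: insert_commute)
    show "?\<mu> (\<theta> u) (\<theta> w) = ?\<mu> u w" using aut u w unfolding graph_automorphism_def by auto
  qed (use T fin in auto)
  have "sparse_multigraph V ?\<mu>"
    unfolding sparse_multigraph_def
  proof (intro allI impI)
    fix X assume X: "X \<subseteq> V" "X \<noteq> {}"
    have "{e \<in> E. e \<subseteq> X} \<subseteq> E" "\<forall>e\<in>{e \<in> E. e \<subseteq> X}. e \<subseteq> X" by auto
    then have "int (card {e \<in> E. e \<subseteq> X}) \<le> 2 * int (card X) - 2"
      using tight X unfolding tight22_def by blast
    then show "degree_sum ?\<mu> X + 4 \<le> 4 * card X"
      unfolding degree_sum_simple_graph[OF g X(1)] by linarith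
  qed
  moreover have E: "{e \<in> E. e \<subseteq> V} = E" using simple_graph_edge_subset[OF g] by auto
  have card: "card E + 2 = 2 * card V" using tight unfolding tight22_def by linarith
  then have "degree_sum ?\<mu> V + 4 = 4 * card V"
    unfolding degree_sum_simple_graph[OF g order_refl] E by linarith
  ultimately have "tight_multigraph V ?\<mu>" unfolding tight_multigraph_def by blast
  then obtain x y z where P: "sym_placement V \<theta> x y z" and R: "parity_rigid V \<theta> ?\<mu> x y z"
    using tight_parity_rigid[OF G] by blast
  let ?p = "\<lambda>v. vector [x v, y v, z v] :: real^3"
  have cyl: "\<forall>v\<in>V. on_cylinder (?p v)"
    using sym_placementD(1)[OF P] by (simp add: on_cylinder_def vector_3)
  have rig: "inf_rigid V E ?p" by (rule parity_rigid_inf_rigid[OF g aut inv P R])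
  have "?p u \<noteq> ?p w" if e: "{u, w} \<in> E" for u w
  proof -
    have uw: "u \<noteq> w" "u \<in> V" "w \<in> V" using loopless[OF e] by auto
    then have "x u \<noteq> x w \<or> y u \<noteq> y w" using sym_placement_distinct[OF P] by blast
    then show ?thesis by (auto simp: vec_eq_iff forall_3 vector_3)
  qed
  then have "framework_on_Y V E ?p" using cyl unfolding framework_on_Y_def by blast
  moreover have "\<forall>v\<in>V. ?p (\<theta> v) = - ?p v"
    using sym_placementD(2-4)[OF P] by (simp add: vec_eq_iff forall_3 vector_3)
  moreover have "isostatic V E ?p"
    unfolding isostatic_def
    using inf_rigid_rows_independent[OF g V cyl rig card] rig inf_rigid_iff_kernel[OF g cyl] by blast
  ultimately show ?thesis unfolding Ci_isostatic_def by (intro exI[of _ ?p] conjI)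
qed

theorem theorem5p11:
  fixes V :: "'a set" and E :: "'a set set" and \<theta> :: "'a \<Rightarrow> 'a"
  assumes "simple_graph V E" and "V \<noteq> {}"
    and "graph_automorphism V E \<theta>" and "involution_on V \<theta>"
  shows "Ci_isostatic V E \<theta> \<longleftrightarrow>
           tight22 V E \<and> \<not> fixes_some_vertex V \<theta> \<and> \<not> fixes_some_edge E \<theta>"
proof
  assume "Ci_isostatic V E \<theta>"
  then obtain p where fw: "framework_on_Y V E p" and sym: "\<forall>v\<in>V. p (\<theta> v) = - p v"
    and iso: "isostatic V E p" unfolding Ci_isostatic_def by blast
  have cyl: "\<forall>v\<in>V. on_cylinder (p v)" using fw unfolding framework_on_Y_def by blast
  have ind: "rows_independent V E p" and rig: "inf_rigid V E p"
    using iso inf_rigid_iff_kernel[OF assms(1) cyl] unfolding isostatic_def by blast+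
  note fin = simple_graph_finite[OF assms(1)]
  have sub: "\<forall>e\<in>E. e \<subseteq> V" using simple_graph_edge_subset[OF assms(1)] by auto
  have le: "card E + 2 \<le> 2 * card V"
    using rows_independent_sparse[OF assms(1) cyl ind order_refl assms(2) order_refl sub] .
  \<comment> \<open>Rigidity bounds the number of edges from below, and independence has bounded it
    from above.\<close>
  have ge: "2 * card V \<le> card E + 2"
    by (rule inf_rigid_count_rows[OF rig fin assms(2)]) blast
  have nov: "\<not> fixes_some_vertex V \<theta>"
  proof
    assume "fixes_some_vertex V \<theta>"
    then obtain v where v: "v \<in> V" "\<theta> v = v" unfolding fixes_some_vertex_def by blast
    \<comment> \<open>Inversion fixes only the origin, which is not on the cylinder.\<close>
    then have "p v = - p v" using sym by metis
    then have "p v = 0" by (simp add: vec_eq_iff)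
    then show False using cyl v by (auto simp: on_cylinder_def)
  qed
  have "int (card E') \<le> 2 * int (card V') - 2"
    if "V' \<subseteq> V \<and> V' \<noteq> {} \<and> E' \<subseteq> E \<and> (\<forall>e\<in>E'. e \<subseteq> V')" for V' E'
    using rows_independent_sparse[OF assms(1) cyl ind, of V' E'] that by linarith
  then have "tight22 V E" using le ge unfolding tight22_def by auto
  moreover have "\<not> fixes_some_edge E \<theta>"
    by (rule inf_rigid_no_fixed_edge[OF assms nov sym rig le])
  ultimately show "tight22 V E \<and> \<not> fixes_some_vertex V \<theta> \<and> \<not> fixes_some_edge E \<theta>"
    using nov by blast
next
  assume "tight22 V E \<and> \<not> fixes_some_vertex V \<theta> \<and> \<not> fixes_some_edge E \<theta>"
  then show "Ci_isostatic V E \<theta>" using tight_Ci_isostatic[OF assms] by blast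
qed

end
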